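(* Let $\beta\in(0,1]$, $R>0$, and let $p\ge 1$ be a real number. For $n\in\mathbb{N}$ and $g\in\mathcal{C}^\beta(R)$, $$\hat F_p=\int_0^1|\hat{g}^{MLE}(x)|^p\,dx-\frac{1}{n}\sum_{j\ge 1}p|Y_j|^{p-1}\operatorname{sgn}(Y_j)\mathbf{1}\big(\hat{g}^{MLE}(X_j)\ge Y_j\big)$$ is an unbiased estimator of $\|g\|_p^p$ with $$\mathbb{E}_g\big[(\hat F_p-\| g\|_p^p)^2\big]\le C\max\Big(\|g\|_{2p-2}^{2p-2}\,n^{-\frac{2\beta+1}{\beta+1}},\;n^{-\frac{2\beta p+1}{\beta+1}}\Big),$$ where $C$ is a constant depending only on $R$, $\beta$ and $p$.
   Context: Model (PPP model): one observes the support points $(X_j,Y_j)_{j\ge1}$ of a Poisson point process on $[0,1]\times\mathbb{R}$ with intensity function $\lambda_g(x,y)=n\mathbf{1}(y\ge g(x))$, $x\in[0,1]$, $y\in\mathbb{R}$, where $g$ is an unknown support boundary curve. $\mathbb{E}_g$ denotes expectation under this law. Hölder ball: $\mathcal{C}^\beta(R)=\{g:[0,1]\to\mathbb{R}: |g(x)-g(y)|\le R|x-y|^\beta\ \forall x,y\in[0,1]\}$. The maximum-likelihood estimator over $\mathcal{C}^\beta(R)$ is $\hat g^{MLE}(x)=\min_{k\ge 1}\big(Y_k+R|x-X_k|^{\beta}\big)$, $x\in[0,1]$. Notation: $\|g\|_q^q=\int_0^1|g(x)|^q\,dx$, used also for $0<q<1$, with the convention $\|g\|_0^0:=1$. *)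

theory Defs
  imports "HOL-Probability.Probability"
begin

text \<open>
  A Poisson point process is represented by the joint law \<open>P\<close> of an enumeration
  \<open>z 0, z 1, \<dots>\<close> of its (almost surely infinitely many) support points, a probability
  measure on sequence space.
\<close>

definition num_points :: "'a set \<Rightarrow> (nat \<Rightarrow> 'a) \<Rightarrow> ennreal" where
  "num_points A z = emeasure (count_space UNIV) {j. z j \<in> A}"

text \<open>
  For \<open>\<Lambda>(A) = \<infinity>\<close> no condition on the law of \<open>num_points A\<close> is imposed; when \<open>\<Lambda>\<close> is sigma-finite
  it is almost surely infinite as a consequence of the conditions below. Finite disjoint
  families are covered by padding with empty sets.
\<close>

definition poisson_point_process :: "'a measure \<Rightarrow> (nat \<Rightarrow> 'a) measure \<Rightarrow> bool" where
  "poisson_point_process \<Lambda> P \<longleftrightarrow>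
     prob_space P \<and>
     sets P = sets (\<Pi>\<^sub>M j\<in>(UNIV :: nat set). \<Lambda>) \<and>
     (\<forall>A\<in>sets \<Lambda>. emeasure \<Lambda> A < \<infinity> \<longrightarrow>
        (\<forall>k. measure P {z \<in> space P. num_points A z = of_nat k} =
             measure \<Lambda> A ^ k / fact k * exp (- measure \<Lambda> A))) \<and>
     (\<forall>A :: nat \<Rightarrow> 'a set. range A \<subseteq> sets \<Lambda> \<and> disjoint_family A \<longrightarrow>
        prob_space.indep_vars P (\<lambda>_. borel) (\<lambda>i. num_points (A i)) UNIV)"

definition ppp_intensity :: "nat \<Rightarrow> (real \<Rightarrow> real) \<Rightarrow> (real \<times> real) measure" where
  "ppp_intensity n g =
     density (restrict_space lborel ({0..1} \<times> UNIV))
       (\<lambda>(x, y). of_nat n * indicator {g x..} y)"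

definition holder_ball :: "real \<Rightarrow> real \<Rightarrow> (real \<Rightarrow> real) set" where
  "holder_ball \<beta> R =
     {g. \<forall>x\<in>{0..1}. \<forall>y\<in>{0..1}. \<bar>g x - g y\<bar> \<le> R * \<bar>x - y\<bar> powr \<beta>}"

text \<open>
  The minimum over the infinitely many support points is written as an infimum; it is
  attained almost surely under the Poisson point process model.
\<close>

definition mle :: "real \<Rightarrow> real \<Rightarrow> (nat \<Rightarrow> real \<times> real) \<Rightarrow> real \<Rightarrow> real" where
  "mle \<beta> R z x = (INF k. snd (z k) + R * \<bar>x - fst (z k)\<bar> powr \<beta>)"

text \<open>
  The \<open>q\<close>-th power of the \<open>L\<^sup>q\<close> (quasi-)norm on \<open>[0,1]\<close>. The case \<open>q = 0\<close> is a convention and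
  needs separate treatment because \<open>0 powr 0 = 0\<close>.
\<close>

definition Lq_norm_pow :: "real \<Rightarrow> (real \<Rightarrow> real) \<Rightarrow> real" where
  "Lq_norm_pow q g = (if q = 0 then 1 else (LINT x:{0..1}|lborel. \<bar>g x\<bar> powr q))"

text \<open>
  Almost surely only finitely many terms of the series are nonzero. For \<open>p = 1\<close> and \<open>Y\<^sub>j = 0\<close>
  the value of \<open>0 powr 0\<close> is irrelevant because of the factor \<open>sgn 0 = 0\<close>.
\<close>

definition F_hat :: "real \<Rightarrow> real \<Rightarrow> real \<Rightarrow> nat \<Rightarrow> (nat \<Rightarrow> real \<times> real) \<Rightarrow> real" where
  "F_hat \<beta> R p n z =
     (LINT x:{0..1}|lborel. \<bar>mle \<beta> R z x\<bar> powr p) -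
     1 / real n *
       (\<Sum>j. p * \<bar>snd (z j)\<bar> powr (p - 1) * sgn (snd (z j)) *
             of_bool (mle \<beta> R z (fst (z j)) \<ge> snd (z j)))"

end

theory Submission
  imports Defs
begin

text \<open>
  Almost surely \<open>g \<le> mle\<close> on \<open>[0,1]\<close>, and a point \<open>w\<close> at height \<open>y\<close> over \<open>x\<close> satisfies \<open>y \<le> mle x\<close> iff no
  point of the process lies in the cone-shaped region \<open>D w\<close> strictly below \<open>w\<close>. With
  \<open>h y = p \<bar>y\<bar>\<^sup>p\<^sup>-\<^sup>1 sgn y\<close>, the derivative of \<open>\<bar>y\<bar>\<^sup>p\<close>, the error of the estimator is therefore \<open>- 1 / n\<close> times the
  compensated sum
  \<open>T = (\<Sum>j. h (Y j) 1{D (X j, Y j) empty}) - (\<integral> h(y) 1{D (x, y) empty} d\<Lambda>)\<close>.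

  Since \<open>z \<in> D w\<close> and \<open>w \<in> D z\<close> exclude each other, \<open>T\<close> behaves like a martingale: \<open>E T = 0\<close> and
  \<open>E T\<^sup>2 = E (\<integral> h\<^sup>2 1{D empty} d\<Lambda>)\<close>. Instead of using a Mecke formula, this is obtained by replacing the points
  by cell counts on dyadic grids, where \<open>T\<close> becomes a finite sum of products of independent Poisson variables,
  and passing to the limit; only the inequality for the second moment survives the limit, which is enough.

  Finally \<open>D (x, g x + s)\<close> has intensity at least of order \<open>n s min(1, s\<^bsup>1/\<beta>\<^esup>)\<close>, so that \<open>mle x - g x\<close> has
  exponential tails on the scale \<open>n\<^bsup>-\<beta>/(\<beta>+1)\<^esup>\<close>, and the remaining integral is a Gamma integral.
\<close>

subsection \<open>Second moments of centred random variables\<close>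

text \<open>The obstacle is that \<open>P\<close> is known only through counts of fixed sets,
  whereas each point in \<open>T\<close> is weighted by an event that depends on where that point
  lies. On a grid this dependence disappears: all points of a cell share one weight, which is a
  function of the counts of other cells.

  That \<open>T\<close> is the right object comes from the fundamental theorem of calculus: over
  each \<open>x\<close> the compensator integrates \<open>h\<close> from \<open>g x\<close> to
  \<open>mle x\<close>, which gives \<open>\<bar>mle x\<bar>^p - \<bar>g x\<bar>^p\<close>. The
  second term of the estimator thus removes the bias of the plug-in integral exactly.

  The total intensity is infinite, so heights are first cut at a level \<open>M\<close>. This costs
  nothing in the end: the cone of a single point bounds \<open>mle\<close> on [0,1], so for each
  outcome the cut is inactive from some \<open>M\<close> on. There are therefore two limits, first
  in the mesh and then in \<open>M\<close>. Neither comes with an integrable dominating function for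
  the error itself, and both are controlled by a bound on second moments.\<close>

lemma (in prob_space) abs_expectation_truncation_le:
  fixes X :: "'a \<Rightarrow> real"
  assumes X [measurable]: "X \<in> borel_measurable M"
    and sq: "integrable M (\<lambda>x. (X x)\<^sup>2)" and le: "expectation (\<lambda>x. (X x)\<^sup>2) \<le> K" and c: "c > 0"
  shows "\<bar>expectation X - expectation (\<lambda>x. max (- c) (min c (X x)))\<bar> \<le> K / c"
proof -
  have iX: "integrable M X"
    by (rule square_integrable_imp_integrable[OF X sq])
  have iT: "integrable M (\<lambda>x. max (- c) (min c (X x)))"
    by (rule integrable_const_bound[where B = c]) (use c in auto)
  have "\<bar>expectation X - expectation (\<lambda>x. max (- c) (min c (X x)))\<bar>
      = \<bar>expectation (\<lambda>x. X x - max (- c) (min c (X x)))\<bar>"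
    using iX iT by simp
  also have "\<dots> \<le> expectation (\<lambda>x. \<bar>X x - max (- c) (min c (X x))\<bar>)"
    by (rule integral_abs_bound)
  also have "\<dots> \<le> expectation (\<lambda>x. (X x)\<^sup>2 / c)"
  proof (rule integral_mono)
    show "integrable M (\<lambda>x. \<bar>X x - max (- c) (min c (X x))\<bar>)" using iX iT by simp
    show "integrable M (\<lambda>x. (X x)\<^sup>2 / c)" using sq by simp
    fix x
    \<comment> \<open>Where the truncation acts, both the overshoot and \<open>c\<close> are at most
      \<open>\<bar>X x\<bar>\<close>; elsewhere the left side is 0.\<close>
    have "\<bar>X x - max (- c) (min c (X x))\<bar> * c \<le> (X x)\<^sup>2"
    proof (cases "\<bar>X x\<bar> \<le> c")
      case False
      have "\<bar>X x - max (- c) (min c (X x))\<bar> * c \<le> \<bar>X x\<bar> * \<bar>X x\<bar>"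
        using c False by (intro mult_mono) (auto simp: max_def min_def)
      then show ?thesis by (simp add: power2_eq_square)
    qed (use c in \<open>auto simp: max_def min_def abs_le_iff\<close>)
    then show "\<bar>X x - max (- c) (min c (X x))\<bar> \<le> (X x)\<^sup>2 / c"
      using c by (simp add: field_simps)
  qed
  also have "\<dots> \<le> K / c"
    using le c by (simp add: divide_right_mono)
  finally show ?thesis .
qed

text \<open>Fatou's lemma bounds the second moment of the limit but may lose equality. The mean
  survives because the second moments make the sequence uniformly integrable: truncating at
  \<open>c\<close> changes each mean by at most \<open>K m / c\<close>, and the truncated variables
  fall under dominated convergence.\<close>

lemma (in prob_space) L2_bounded_limit:
  fixes X :: "nat \<Rightarrow> 'a \<Rightarrow> real"
  assumes X [measurable]: "\<And>m. X m \<in> borel_measurable M" and Y [measurable]: "Y \<in> borel_measurable M"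
    and lim: "AE x in M. (\<lambda>m. X m x) \<longlonglongrightarrow> Y x"
    and sq: "\<And>m. integrable M (\<lambda>x. (X m x)\<^sup>2)"
    and mean: "\<And>m. expectation (X m) = 0"
    and le: "\<And>m. expectation (\<lambda>x. (X m x)\<^sup>2) \<le> K m" and K: "K \<longlonglongrightarrow> L"
  shows "integrable M (\<lambda>x. (Y x)\<^sup>2)" "expectation Y = 0" "expectation (\<lambda>x. (Y x)\<^sup>2) \<le> L"
proof -
  have L0: "0 \<le> L"
  proof (rule LIMSEQ_le_const[OF K], intro exI allI impI)
    show "0 \<le> K m" for m
      by (rule order_trans[OF _ le[of m]]) simp
  qed
  have "(\<integral>\<^sup>+x. ennreal ((Y x)\<^sup>2) \<partial>M) = (\<integral>\<^sup>+x. liminf (\<lambda>m. ennreal ((X m x)\<^sup>2)) \<partial>M)"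
  proof (rule nn_integral_cong_AE)
    show "AE x in M. ennreal ((Y x)\<^sup>2) = liminf (\<lambda>m. ennreal ((X m x)\<^sup>2))"
      using lim
    proof eventually_elim
      case (elim x)
      then have "(\<lambda>m. ennreal ((X m x)\<^sup>2)) \<longlonglongrightarrow> ennreal ((Y x)\<^sup>2)"
        by (intro tendsto_ennrealI tendsto_power)
      from lim_imp_Liminf[OF _ this] show ?case by simp
    qed
  qed
  also have "\<dots> \<le> liminf (\<lambda>m. \<integral>\<^sup>+x. ennreal ((X m x)\<^sup>2) \<partial>M)"
    by (rule nn_integral_liminf) auto
  also have "\<dots> \<le> liminf (\<lambda>m. ennreal (K m))"
    using sq le by (intro Liminf_mono) (auto simp: nn_integral_eq_integral ennreal_leI)
  also have "\<dots> = ennreal L"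
    using K by (intro lim_imp_Liminf tendsto_ennrealI) auto
  finally have nn: "(\<integral>\<^sup>+x. ennreal ((Y x)\<^sup>2) \<partial>M) \<le> ennreal L" .
  then show iY: "integrable M (\<lambda>x. (Y x)\<^sup>2)"
    by (intro integrableI_bounded) (auto simp: le_less_trans[OF _ ennreal_less_top])
  then have "ennreal (expectation (\<lambda>x. (Y x)\<^sup>2)) \<le> ennreal L"
    using nn by (subst nn_integral_eq_integral[symmetric]) auto
  then show leY: "expectation (\<lambda>x. (Y x)\<^sup>2) \<le> L"
    using L0 by simp
  have bound: "\<bar>expectation Y\<bar> \<le> 2 * L / c" if c: "c > 0" for c
  proof -
    have "(\<lambda>m. expectation (\<lambda>x. max (- c) (min c (X m x)))) \<longlonglongrightarrow> expectation (\<lambda>x. max (- c) (min c (Y x)))"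
    proof (rule integral_dominated_convergence[where w = "\<lambda>_. c"])
      show "AE x in M. (\<lambda>m. max (- c) (min c (X m x))) \<longlonglongrightarrow> max (- c) (min c (Y x))"
        using lim by eventually_elim (intro tendsto_intros)
    qed (use c in auto)
    moreover have "\<bar>expectation (\<lambda>x. max (- c) (min c (X m x)))\<bar> \<le> K m / c" for m
      using abs_expectation_truncation_le[OF X sq le c, of m] mean[of m] by simp
    ultimately have "\<bar>expectation (\<lambda>x. max (- c) (min c (Y x)))\<bar> \<le> L / c"
      using K c by (intro LIMSEQ_le[OF tendsto_rabs tendsto_divide[OF K tendsto_const[of c]]]) auto
    then have "\<bar>expectation Y\<bar> \<le> L / c + L / c"
      using abs_expectation_truncation_le[OF Y iY leY c] by linarith
    then show ?thesis by simp
  qed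
  show "expectation Y = 0"
  proof (rule ccontr)
    assume "expectation Y \<noteq> 0"
    then have e: "\<bar>expectation Y\<bar> > 0" by simp
    \<comment> \<open>The level \<open>c\<close> is chosen so that the bound becomes less than
      \<open>\<bar>expectation Y\<bar>\<close>; the \<open>+ 1\<close> keeps it positive when
      \<open>L = 0\<close>.\<close>
    have "\<bar>expectation Y\<bar> \<le> 2 * L / (2 * (2 * L + 1) / \<bar>expectation Y\<bar>)"
      using e L0 by (intro bound) auto
    also have "\<dots> = \<bar>expectation Y\<bar> * (2 * L / (2 * (2 * L + 1)))"
      by simp
    also have "\<dots> < \<bar>expectation Y\<bar> * 1"
      using e L0 by (intro mult_strict_left_mono) (auto simp: field_simps)
    finally show False by simp
  qed
qed

text \<open>The off-diagonal second moments vanish because of two cells \<open>i \<noteq> j\<close> one, say \<open>i\<close>, does not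
  belong to \<open>d j\<close>; then \<open>N i - l i\<close> is an independent centred factor.\<close>

lemma (in prob_space) compensated_void_sum:
  fixes N :: "'b \<Rightarrow> 'a \<Rightarrow> real" and c l :: "'b \<Rightarrow> real"
  assumes Q: "finite Q" and ind: "indep_vars (\<lambda>_. borel) N Q"
    and int: "\<And>i. i \<in> Q \<Longrightarrow> integrable M (N i)"
    and mean: "\<And>i. i \<in> Q \<Longrightarrow> expectation (N i) = l i"
    and sq: "\<And>i. i \<in> Q \<Longrightarrow> integrable M (\<lambda>x. (N i x - l i)\<^sup>2)"
    and var: "\<And>i. i \<in> Q \<Longrightarrow> expectation (\<lambda>x. (N i x - l i)\<^sup>2) = l i"
    and d: "\<And>i. i \<in> Q \<Longrightarrow> d i \<subseteq> Q"
    and asym: "\<And>i j. i \<in> Q \<Longrightarrow> j \<in> Q \<Longrightarrow> i \<in> d j \<Longrightarrow> j \<notin> d i"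
  defines "E \<equiv> \<lambda>i x. \<Prod>k\<in>d i. of_bool (N k x = 0)"
  defines "T \<equiv> \<lambda>x. \<Sum>i\<in>Q. c i * (N i x - l i) * E i x"
  shows "integrable M (\<lambda>x. (T x)\<^sup>2)" "expectation T = 0"
    "expectation (\<lambda>x. (T x)\<^sup>2) = (\<Sum>i\<in>Q. (c i)\<^sup>2 * l i * expectation (E i))"
proof -
  have [measurable]: "\<And>i. i \<in> Q \<Longrightarrow> N i \<in> borel_measurable M"
    using ind by (auto simp: indep_vars_def)
  have factor: "integrable M (\<lambda>x. \<Prod>k\<in>Q. f k (N k x)) \<and>
      expectation (\<lambda>x. \<Prod>k\<in>Q. f k (N k x)) = (\<Prod>k\<in>Q. expectation (\<lambda>x. f k (N k x)))"
    if f: "\<And>k. k \<in> Q \<Longrightarrow> f k \<in> borel_measurable borel"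
      "\<And>k. k \<in> Q \<Longrightarrow> integrable M (\<lambda>x. f k (N k x))" for f :: "'b \<Rightarrow> real \<Rightarrow> real"
  proof -
    have "indep_vars (\<lambda>_. borel) (\<lambda>k x. f k (N k x)) Q"
      by (rule indep_vars_compose2[OF ind]) (use f in auto)
    from indep_vars_lebesgue_integral[OF Q this] indep_vars_integrable[OF Q this] f
    show ?thesis by auto
  qed
  \<comment> \<open>Factor \<open>k\<close> of the summand \<open>i\<close>, as a function of
    \<open>N k\<close> alone. With a factor for every \<open>k\<close> in \<open>Q\<close>, trivial
    ones included, independence turns expectations of summands and of their products into products
    over \<open>Q\<close>.\<close>
  let ?f = "\<lambda>i k t. (if k = i then t - l i else 1) * (if k \<in> d i then of_bool (t = 0) else 1 :: real)"
  have di: "i \<notin> d i" if "i \<in> Q" for i using asym[of i i] that by blast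
  \<comment> \<open>The void indicators are bounded by 1, so only the centred factors matter; the
    square occurs for \<open>k = i = j\<close>.\<close>
  have f_int: "integrable M (\<lambda>x. ?f i k (N k x) * ?f j k (N k x))" if "i \<in> Q" "j \<in> Q" "k \<in> Q" for i j k
  proof -
    have "integrable M (\<lambda>x. ((if k = i then N k x - l i else 1) * (if k = j then N k x - l j else 1)) *
        (of_bool (k \<in> d i \<union> d j \<longrightarrow> N k x = 0)))"
    proof (rule Bochner_Integration.integrable_bound)
      show "integrable M (\<lambda>x. ((if k = i then N k x - l i else 1) * (if k = j then N k x - l j else 1)))"
        using that int[of i] int[of j] sq[of i]
        by (cases "k = i"; cases "k = j"; simp add: power2_eq_square)
    qed (use that in auto)
    then show ?thesis
      by (rule back_subst[of "integrable M"]) (auto simp: fun_eq_iff)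
  qed
  have f1_int: "integrable M (\<lambda>x. ?f i k (N k x))" if "i \<in> Q" "k \<in> Q" for i k
  proof -
    have "integrable M (\<lambda>x. (if k = i then N k x - l i else 1) * (of_bool (k \<in> d i \<longrightarrow> N k x = 0)))"
    proof (rule Bochner_Integration.integrable_bound)
      show "integrable M (\<lambda>x. (if k = i then N k x - l i else 1))"
        using that int[of i] by (cases "k = i"; simp)
    qed (use that in auto)
    then show ?thesis
      by (rule back_subst[of "integrable M"]) (auto simp: fun_eq_iff)
  qed
  have E_eq: "E i x = (\<Prod>k\<in>Q. if k \<in> d i then of_bool (N k x = 0) else 1)" if "i \<in> Q" for i x
    unfolding E_def using d[OF that] Q by (simp add: prod.If_cases Int_absorb1 Int_commute inf.absorb2)
  have T_eq: "(N i x - l i) * E i x = (\<Prod>k\<in>Q. ?f i k (N k x))" if "i \<in> Q" for i x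
    using that Q by (simp add: prod.distrib E_eq prod.delta)
  have term1: "integrable M (\<lambda>x. (N i x - l i) * E i x)" "expectation (\<lambda>x. (N i x - l i) * E i x) = 0" if i: "i \<in> Q" for i
  proof -
    have fm: "?f i k \<in> borel_measurable borel" for k by measurable
    note F = factor[of "?f i", OF fm f1_int[OF i]]
    show "integrable M (\<lambda>x. (N i x - l i) * E i x)" using F by (simp add: T_eq[OF i])
    have "expectation (\<lambda>x. (N i x - l i) * E i x) = (\<Prod>k\<in>Q. expectation (\<lambda>x. ?f i k (N k x)))"
      using F by (simp add: T_eq[OF i])
    also have "\<dots> = 0"
      using i di[OF i] mean[OF i] int[OF i] Q by (intro prod_zero) (auto intro!: bexI[of _ i] simp: prob_space)
    finally show "expectation (\<lambda>x. (N i x - l i) * E i x) = 0" .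
  qed
  have term2: "integrable M (\<lambda>x. ((N i x - l i) * E i x) * ((N j x - l j) * E j x))"
      "expectation (\<lambda>x. ((N i x - l i) * E i x) * ((N j x - l j) * E j x)) =
        (if i = j then l i * expectation (E i) else 0)" if i: "i \<in> Q" and j: "j \<in> Q" for i j
  proof -
    have fm: "(\<lambda>t. ?f i k t * ?f j k t) \<in> borel_measurable borel" for k by measurable
    have eq: "((N i x - l i) * E i x) * ((N j x - l j) * E j x) = (\<Prod>k\<in>Q. ?f i k (N k x) * ?f j k (N k x))" for x
      by (simp only: T_eq[OF i] T_eq[OF j] prod.distrib)
    note F = factor[of "\<lambda>k t. ?f i k t * ?f j k t", OF fm f_int[OF i j]]
    show "integrable M (\<lambda>x. ((N i x - l i) * E i x) * ((N j x - l j) * E j x))"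
      unfolding eq using F by (rule conjunct1)
    have ex: "expectation (\<lambda>x. ((N i x - l i) * E i x) * ((N j x - l j) * E j x))
        = (\<Prod>k\<in>Q. expectation (\<lambda>x. ?f i k (N k x) * ?f j k (N k x)))"
      unfolding eq using F by (rule conjunct2)
    show "expectation (\<lambda>x. ((N i x - l i) * E i x) * ((N j x - l j) * E j x)) =
        (if i = j then l i * expectation (E i) else 0)"
    proof (cases "i = j")
      case True
      have E: "expectation (E i) = (\<Prod>k\<in>Q. expectation (\<lambda>x. if k \<in> d i then of_bool (N k x = 0) else 1))"
        using factor[of "\<lambda>k t. if k \<in> d i then of_bool (t = 0) else 1"]
        by (simp add: ext[of "E i", OF E_eq[OF i]] integrable_const_bound[where B = 1])
      have "(\<Prod>k\<in>Q. expectation (\<lambda>x. ?f i k (N k x) * ?f i k (N k x)))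
          = (\<Prod>k\<in>Q. (if k = i then l i else 1) * expectation (\<lambda>x. if k \<in> d i then of_bool (N k x = 0) else 1))"
        using di[OF i] var[OF i]
        by (intro prod.cong refl) (auto simp: power2_eq_square prob_space intro!: Bochner_Integration.integral_cong)
      also have "\<dots> = l i * expectation (E i)"
        using i Q by (simp add: prod.distrib E prod.delta)
      finally show ?thesis using ex unfolding True[symmetric] by simp
    next
      case False
      have "(\<Prod>k\<in>Q. expectation (\<lambda>x. ?f i k (N k x) * ?f j k (N k x))) = 0"
      proof (cases "i \<in> d j")
        case True
        then have "j \<notin> d i" "j \<notin> d j" using asym i j di by auto
        then show ?thesis using False j mean[OF j] int[OF j] Q
          by (intro prod_zero) (auto intro!: bexI[of _ j] simp: prob_space)
      next
        case notin: False
        then show ?thesis using False i di[OF i] mean[OF i] int[OF i] Q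
          by (intro prod_zero) (auto intro!: bexI[of _ i] simp: prob_space)
      qed
      then show ?thesis using ex False by simp
    qed
  qed
  show "expectation T = 0"
    unfolding T_def using term1 by (simp add: mult.assoc)
  have Tsq: "(T x)\<^sup>2 = (\<Sum>i\<in>Q. \<Sum>j\<in>Q. (c i * c j) * (((N i x - l i) * E i x) * ((N j x - l j) * E j x)))" for x
    unfolding T_def power2_eq_square sum_product by (intro sum.cong refl) (simp add: mult_ac)
  show "integrable M (\<lambda>x. (T x)\<^sup>2)"
    unfolding Tsq using term2 by (intro Bochner_Integration.integrable_sum integrable_mult_right) auto
  have "expectation (\<lambda>x. (T x)\<^sup>2) = (\<Sum>i\<in>Q. \<Sum>j\<in>Q. (c i * c j) * (if i = j then l i * expectation (E i) else 0))"
    unfolding Tsq using term2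
    by (subst Bochner_Integration.integral_sum, force)+ (intro sum.cong refl, simp)
  also have "\<dots> = (\<Sum>i\<in>Q. (c i)\<^sup>2 * l i * expectation (E i))"
    using Q by (intro sum.cong refl) (simp add: if_distrib[of "\<lambda>t. _ * t"] sum.delta power2_eq_square cong: if_cong)
  finally show "expectation (\<lambda>x. (T x)\<^sup>2) = (\<Sum>i\<in>Q. (c i)\<^sup>2 * l i * expectation (E i))" .
qed

section \<open>Moments of Poisson variables\<close>

lemma poisson_sums:
  fixes l :: real
  shows "(\<lambda>k. l ^ k / fact k * exp (- l)) sums 1"
    "(\<lambda>k. real k * (l ^ k / fact k * exp (- l))) sums l"
    "(\<lambda>k. (real k)\<^sup>2 * (l ^ k / fact k * exp (- l))) sums (l\<^sup>2 + l)"
proof -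
  have exp: "(\<lambda>k. l ^ k / fact k) sums exp l"
    using exp_converges[of l] by (simp add: scaleR_conv_of_real divide_inverse mult.commute)
  from sums_mult2[OF this, of "exp (- l)"] show 1: "(\<lambda>k. l ^ k / fact k * exp (- l)) sums 1"
    by (simp add: exp_minus)
  \<comment> \<open>Shifting the index cancels the factor against the factorial and reduces each sum
    to the preceding ones.\<close>
  have "(\<lambda>k. real (Suc k) * (l ^ Suc k / fact (Suc k) * exp (- l))) sums l"
    using sums_mult[OF 1, of l] by (simp add: field_simps del: of_nat_Suc)
  then show 2: "(\<lambda>k. real k * (l ^ k / fact k * exp (- l))) sums l"
    by (subst (asm) sums_Suc_iff) simp
  have "(\<lambda>k. (real (Suc k))\<^sup>2 * (l ^ Suc k / fact (Suc k) * exp (- l))) sums (l * l + l)"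
  proof -
    have "(real (Suc k))\<^sup>2 * (l ^ Suc k / fact (Suc k) * exp (- l))
        = l * (real k * (l ^ k / fact k * exp (- l))) + l * (l ^ k / fact k * exp (- l))" for k
    proof -
      have "(real (Suc k))\<^sup>2 * (l ^ Suc k / fact (Suc k) * exp (- l)) = real (Suc k) * (l * (l ^ k / fact k * exp (- l)))"
        by (simp add: power2_eq_square del: of_nat_Suc)
      also have "\<dots> = l * (real k * (l ^ k / fact k * exp (- l))) + l * (l ^ k / fact k * exp (- l))"
        by (simp add: algebra_simps add_divide_distrib)
      finally show ?thesis .
    qed
    then show ?thesis
      using sums_add[OF sums_mult[OF 2, of l] sums_mult[OF 1, of l]] by (simp only: mult_1_right)
  qed
  then show "(\<lambda>k. (real k)\<^sup>2 * (l ^ k / fact k * exp (- l))) sums (l\<^sup>2 + l)"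
    by (subst (asm) sums_Suc_iff) (simp add: power2_eq_square)
qed

lemma (in prob_space) integral_nat_valued:
  fixes X :: "'a \<Rightarrow> nat" and f :: "nat \<Rightarrow> real"
  assumes X [measurable]: "X \<in> measurable M (count_space UNIV)"
    and f: "\<And>k. 0 \<le> f k" and s: "(\<lambda>k. f k * prob {x\<in>space M. X x = k}) sums s"
  shows "integrable M (\<lambda>x. f (X x))" "expectation (\<lambda>x. f (X x)) = s"
proof -
  have s0: "0 \<le> s" by (rule sums_le[OF _ sums_zero s]) (use f in auto)
  have "(\<integral>\<^sup>+x. ennreal (f (X x)) \<partial>M) = (\<integral>\<^sup>+x. (\<Sum>k. ennreal (f k) * indicator {x\<in>space M. X x = k} x) \<partial>M)"
  proof (rule nn_integral_cong)
    fix x assume x: "x \<in> space M"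
    have "(\<Sum>k. ennreal (f k) * indicator {x\<in>space M. X x = k} x) = (\<Sum>k\<in>{X x}. ennreal (f k) * indicator {x\<in>space M. X x = k} x)"
      by (rule suminf_finite) auto
    then show "ennreal (f (X x)) = (\<Sum>k. ennreal (f k) * indicator {x\<in>space M. X x = k} x)" using x by simp
  qed
  also have "\<dots> = (\<Sum>k. ennreal (f k) * emeasure M {x\<in>space M. X x = k})"
    by (simp add: nn_integral_suminf nn_integral_cmult)
  also have "\<dots> = (\<Sum>k. ennreal (f k * prob {x\<in>space M. X x = k}))"
    using f by (simp add: emeasure_eq_measure ennreal_mult)
  also have "\<dots> = ennreal s"
    using s f by (intro sums_unique[symmetric]) (auto simp: sums_ennreal s0)
  finally have nn: "(\<integral>\<^sup>+x. ennreal (f (X x)) \<partial>M) = ennreal s" .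
  then show "integrable M (\<lambda>x. f (X x))"
    by (intro integrableI_nn_integral_finite[where x = s]) (use f s0 in auto)
  show "expectation (\<lambda>x. f (X x)) = s"
    using nn f s0 by (intro integral_eq_nn_integral[THEN trans]) auto
qed

text \<open>Only the probabilities of finite counts are prescribed. Since they add up to 1, the
  value infinity has probability 0, and \<open>enn2real\<close> loses nothing almost surely.\<close>

lemma (in prob_space) poisson_moments:
  fixes N :: "'a \<Rightarrow> ennreal"
  assumes N [measurable]: "N \<in> borel_measurable M"
    and pois: "\<And>k::nat. prob {x\<in>space M. N x = of_nat k} = l ^ k / fact k * exp (- l)"
  shows "AE x in M. \<exists>k::nat. N x = of_nat k"
    "integrable M (\<lambda>x. enn2real (N x))" "expectation (\<lambda>x. enn2real (N x)) = l"
    "integrable M (\<lambda>x. (enn2real (N x) - l)\<^sup>2)" "expectation (\<lambda>x. (enn2real (N x) - l)\<^sup>2) = l"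
proof -
  have "(\<lambda>k. prob {x\<in>space M. N x = of_nat k}) sums prob (\<Union>k. {x\<in>space M. N x = of_nat k})"
    by (rule finite_measure_UNION) (auto simp: disjoint_family_on_def)
  moreover have "(\<lambda>k. prob {x\<in>space M. N x = of_nat k}) sums 1"
    unfolding pois by (rule poisson_sums)
  ultimately have "prob (\<Union>k. {x\<in>space M. N x = of_nat k}) = 1"
    by (rule sums_unique2)
  then have "AE x in M. x \<in> (\<Union>k. {x\<in>space M. N x = of_nat k})"
    by (subst (asm) prob_eq_1) auto
  then show nat: "AE x in M. \<exists>k::nat. N x = of_nat k"
    by eventually_elim auto
  define X where "X = (\<lambda>x. nat \<lfloor>enn2real (N x)\<rfloor>)"
  have X [measurable]: "X \<in> measurable M (count_space UNIV)"
    unfolding X_def by measurable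
  have real: "AE x in M. enn2real (N x) = real (X x)"
    using nat by eventually_elim (auto simp: X_def enn2real_of_nat)
  have NX: "AE x in M. N x = of_nat (X x)"
    using nat by eventually_elim (auto simp: X_def enn2real_of_nat)
  have pX: "prob {x\<in>space M. X x = k} = l ^ k / fact k * exp (- l)" for k
    unfolding pois[symmetric]
    by (rule finite_measure_eq_AE) (use NX in \<open>auto elim!: eventually_mono\<close>)
  note I = integral_nat_valued[OF X, unfolded pX]
  note I1 = I[of real, OF _ poisson_sums(2)] note I2 = I[of "\<lambda>k. (real k)\<^sup>2", OF _ poisson_sums(3)]
  show "integrable M (\<lambda>x. enn2real (N x))"
    by (subst integrable_cong_AE[OF _ _ real]) (use I1 in auto)
  have "expectation (\<lambda>x. enn2real (N x)) = expectation (\<lambda>x. real (X x))"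
    by (rule integral_cong_AE) (use real in auto)
  then show "expectation (\<lambda>x. enn2real (N x)) = l" using I1 by simp
  have eq: "AE x in M. (enn2real (N x) - l)\<^sup>2 = (real (X x))\<^sup>2 - 2 * l * real (X x) + l\<^sup>2"
    using real by eventually_elim (simp add: power2_eq_square algebra_simps)
  show "integrable M (\<lambda>x. (enn2real (N x) - l)\<^sup>2)"
    by (subst integrable_cong_AE[OF _ _ eq]) (use I1 I2 in auto)
  have "expectation (\<lambda>x. (enn2real (N x) - l)\<^sup>2) = expectation (\<lambda>x. (real (X x))\<^sup>2 - 2 * l * real (X x) + l\<^sup>2)"
    by (rule integral_cong_AE) (use eq in auto)
  also have "\<dots> = l"
    using I1 I2 by (simp add: prob_space power2_eq_square)
  finally show "expectation (\<lambda>x. (enn2real (N x) - l)\<^sup>2) = l" .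
qed

subsection \<open>The score function\<close>

text \<open>The second point lies in the region \<open>D\<close> of the first. It certifies that the
  first is strictly above the boundary: a curve of the Hoelder ball that runs on or below
  \<open>w\<close> cannot reach \<open>z\<close>.\<close>

definition below :: "real \<Rightarrow> real \<Rightarrow> real \<times> real \<Rightarrow> real \<times> real \<Rightarrow> bool" where
  "below \<beta> R z w \<longleftrightarrow> snd w + R * \<bar>fst z - fst w\<bar> powr \<beta> < snd z"

definition score :: "real \<Rightarrow> real \<Rightarrow> real" where
  "score p y = p * \<bar>y\<bar> powr (p - 1) * sgn y"

lemma measurable_ident_borel_pair:
  "(\<lambda>w. w) \<in> (borel :: real measure) \<Otimes>\<^sub>M (borel :: real measure) \<rightarrow>\<^sub>M borel \<Otimes>\<^sub>M borel"
  by (rule measurable_ident_sets) simp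

lemma sets_borel_pairI:
  "Measurable.pred ((borel :: real measure) \<Otimes>\<^sub>M (borel :: real measure)) Q \<Longrightarrow> {w. Q w} \<in> sets (borel \<Otimes>\<^sub>M borel)"
  by (drule predE) (simp add: space_pair_measure)

lemma measurable_score [measurable]: "score p \<in> borel_measurable borel"
  unfolding score_def by measurable

lemma measurable_below [measurable]:
  assumes [measurable]: "f \<in> M \<rightarrow>\<^sub>M borel \<Otimes>\<^sub>M borel" "f' \<in> M \<rightarrow>\<^sub>M borel \<Otimes>\<^sub>M borel"
  shows "Measurable.pred M (\<lambda>x. below \<beta> R (f x) (f' x))"
  unfolding below_def by measurable

lemma abs_score_le:
  assumes "p \<ge> 1" "\<bar>y\<bar> \<le> B" "0 < B"
  shows "\<bar>score p y\<bar> \<le> p * B powr (p - 1)"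
  using assms by (auto simp: score_def abs_mult sgn_if powr_mono2)

text \<open>For \<open>p = 1\<close> the score jumps at \<open>0\<close>, but there rounding is exact.\<close>

lemma tendsto_score_floor:
  fixes y :: real
  shows "(\<lambda>m. score p (\<lfloor>2 ^ m * y\<rfloor> / 2 ^ m)) \<longlonglongrightarrow> score p y"
proof (cases "y = 0")
  case False
  have "(\<lambda>m. \<lfloor>2 ^ m * y\<rfloor> / 2 ^ m) \<longlonglongrightarrow> y"
  proof (rule tendsto_sandwich)
    show "(\<lambda>m. y - (1 / 2) ^ m) \<longlonglongrightarrow> y"
      by (rule tendsto_eq_intros LIMSEQ_power_zero | simp)+
    show "\<forall>\<^sub>F m in sequentially. y - (1 / 2) ^ m \<le> \<lfloor>2 ^ m * y\<rfloor> / 2 ^ m"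
    proof (intro always_eventually allI)
      fix m :: nat
      have "2 ^ m * y - 1 \<le> \<lfloor>2 ^ m * y\<rfloor>" by linarith
      then have "(2 ^ m * y - 1) / 2 ^ m \<le> \<lfloor>2 ^ m * y\<rfloor> / 2 ^ m" by (rule divide_right_mono) simp
      then show "y - (1 / 2) ^ m \<le> \<lfloor>2 ^ m * y\<rfloor> / 2 ^ m" by (simp add: diff_divide_distrib power_divide)
    qed
    show "\<forall>\<^sub>F m in sequentially. \<lfloor>2 ^ m * y\<rfloor> / 2 ^ m \<le> y"
      by (intro always_eventually allI) (simp add: pos_divide_le_eq mult.commute)
  qed simp
  moreover from False have "isCont (score p) y"
  proof (cases "y > 0")
    case True
    have "isCont (\<lambda>y. p * \<bar>y\<bar> powr (p - 1)) y" using False by (intro continuous_intros) auto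
    moreover have "\<forall>\<^sub>F x in nhds y. score p x = p * \<bar>x\<bar> powr (p - 1)"
      using order_tendstoD(1)[OF filterlim_ident True] by eventually_elim (simp add: score_def)
    ultimately show ?thesis using isCont_cong by fast
  next
    case neg: False
    then have "y < 0" using False by simp
    have "isCont (\<lambda>y. - (p * \<bar>y\<bar> powr (p - 1))) y" using False by (intro continuous_intros) auto
    moreover have "\<forall>\<^sub>F x in nhds y. score p x = - (p * \<bar>x\<bar> powr (p - 1))"
      using order_tendstoD(2)[OF filterlim_ident \<open>y < 0\<close>] by eventually_elim (simp add: score_def)
    ultimately show ?thesis using isCont_cong by fast
  qed
  ultimately show ?thesis by (rule isCont_tendsto_compose[rotated])
qed simp

text \<open>The exceptional point 0 is forced by \<open>p = 1\<close>, where
  \<open>\<bar>y\<bar>\<close> has a kink; continuity of the antiderivative is enough there.\<close>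

lemma has_integral_score:
  assumes "p \<ge> 1" "a \<le> b"
  shows "(score p has_integral (\<bar>b\<bar> powr p - \<bar>a\<bar> powr p)) {a..b}"
proof (rule fundamental_theorem_of_calculus_interior_strong[where S = "{0}"])
  show "continuous_on {a..b} (\<lambda>y. \<bar>y\<bar> powr p)"
    using assms by (intro continuous_on_powr' continuous_intros) auto
  fix y assume "y \<in> {a<..<b} - {0}"
  then have "y \<noteq> 0" by simp
  show "((\<lambda>y. \<bar>y\<bar> powr p) has_vector_derivative score p y) (at y)"
  proof (cases "y > 0")
    case True
    have "((\<lambda>y. y powr p) has_real_derivative p * y powr (p - 1)) (at y)"
      using True by (rule has_real_derivative_powr)
    moreover have "\<forall>\<^sub>F x in nhds y. \<bar>x\<bar> powr p = x powr p"
      using order_tendstoD(1)[OF filterlim_ident True] by eventually_elim simp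
    ultimately have "((\<lambda>y. \<bar>y\<bar> powr p) has_real_derivative p * y powr (p - 1)) (at y)"
      by (subst DERIV_cong_ev[OF refl _ refl])
    then show ?thesis using True by (simp add: score_def has_real_derivative_iff_has_vector_derivative)
  next
    case False
    then have neg: "y < 0" using \<open>y \<noteq> 0\<close> by simp
    have "((\<lambda>y. (- y) powr p) has_real_derivative - (p * (- y) powr (p - 1))) (at y)"
      using neg by (auto intro!: derivative_eq_intros)
    moreover have "\<forall>\<^sub>F x in nhds y. \<bar>x\<bar> powr p = (- x) powr p"
      using order_tendstoD(2)[OF filterlim_ident neg] by eventually_elim simp
    ultimately have "((\<lambda>y. \<bar>y\<bar> powr p) has_real_derivative - (p * (- y) powr (p - 1))) (at y)"
      by (subst DERIV_cong_ev[OF refl _ refl])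
    then show ?thesis using neg by (simp add: score_def has_real_derivative_iff_has_vector_derivative)
  qed
qed (use assms in auto)

lemma set_integral_score:
  assumes p: "p \<ge> 1" and ab: "a \<le> b"
  shows "(LINT y:{a..b}|lborel. score p y) = \<bar>b\<bar> powr p - \<bar>a\<bar> powr p"
proof -
  let ?B = "\<bar>a\<bar> + \<bar>b\<bar> + 1"
  have "set_integrable lborel {a..b} (score p)"
    unfolding set_integrable_def
  proof (rule Bochner_Integration.integrable_bound)
    show "integrable lborel (\<lambda>y. indicator {a..b} y * (p * ?B powr (p - 1)))"
      using ab by (intro integrable_mult_left integrable_real_indicator) auto
    show "AE y in lborel. norm (indicator {a..b} y *\<^sub>R score p y) \<le> norm (indicator {a..b} y * (p * ?B powr (p - 1)))"
    proof (rule AE_I2)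
      fix y
      have "\<bar>score p y\<bar> \<le> p * ?B powr (p - 1)" if "y \<in> {a..b}"
        using that by (intro abs_score_le[OF p]) auto
      then show "norm (indicator {a..b} y *\<^sub>R score p y) \<le> norm (indicator {a..b} y * (p * ?B powr (p - 1)))"
        using p by (auto simp: indicator_def)
    qed
  qed simp
  then show ?thesis
    using has_integral_score[OF assms] by (simp add: set_borel_integral_eq_integral integral_unique)
qed

section \<open>Analytic ingredients of the variance bound\<close>

lemma nn_integral_powr_exp:
  fixes c q :: real
  assumes c: "c > 0" and q: "q \<ge> 0"
  shows "(\<integral>\<^sup>+s. ennreal (indicator {0..} s * (s powr q * exp (- (c * s)))) \<partial>lborel) = ennreal (Gamma (q + 1) / c powr (q + 1))"
proof -
  let ?I = "\<integral>\<^sup>+s. ennreal (indicator {0..} s * (s powr q * exp (- (c * s)))) \<partial>lborel"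
  have "ennreal (Gamma (q + 1)) = (\<integral>\<^sup>+t. ennreal (indicator {0..} t * t powr q / exp t) \<partial>lborel)"
    using Gamma_conv_nn_integral_real[of "q + 1"] q by simp
  \<comment> \<open>Substitution \<open>t = c * s\<close> in Euler's integral.\<close>
  also have "\<dots> = ennreal c * (\<integral>\<^sup>+s. ennreal (indicator {0..} (0 + c * s) * (0 + c * s) powr q / exp (0 + c * s)) \<partial>lborel)"
    using c by (subst nn_integral_real_affine[where c = c and t = 0]) auto
  also have "(\<lambda>s. ennreal (indicator {0..} (0 + c * s) * (0 + c * s) powr q / exp (0 + c * s)))
      = (\<lambda>s. ennreal (c powr q) * ennreal (indicator {0..} s * (s powr q * exp (- (c * s)))))"
  proof
    fix s
    have "indicator {0..} (0 + c * s) * (0 + c * s) powr q / exp (0 + c * s)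
        = c powr q * (indicator {0..} s * (s powr q * exp (- (c * s))))"
      using c by (cases "s \<ge> 0") (simp_all add: powr_mult exp_minus divide_inverse zero_le_mult_iff)
    then show "ennreal (indicator {0..} (0 + c * s) * (0 + c * s) powr q / exp (0 + c * s))
        = ennreal (c powr q) * ennreal (indicator {0..} s * (s powr q * exp (- (c * s))))"
      by (simp only: ennreal_mult'[OF powr_ge_zero])
  qed
  also have "(\<integral>\<^sup>+s. ennreal (c powr q) * ennreal (indicator {0..} s * (s powr q * exp (- (c * s)))) \<partial>lborel)
      = ennreal (c powr q) * ?I"
    by (intro nn_integral_cmult) measurable
  finally have eq: "ennreal (Gamma (q + 1)) = ennreal c * (ennreal (c powr q) * ?I)" .
  show ?thesis
  proof (cases ?I)
    case (real r)
    have "ennreal (Gamma (q + 1)) = ennreal (c * (c powr q * r))"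
      using eq real c by (simp add: ennreal_mult)
    then have "Gamma (q + 1) = c * (c powr q * r)"
      using q c real by (subst (asm) ennreal_inj) (auto intro!: Gamma_real_nonneg)
    then have "Gamma (q + 1) / c powr (q + 1) = r"
      using c by (simp add: powr_add)
    then show ?thesis using real by simp
  next
    case top
    then show ?thesis using eq c by (simp add: ennreal_mult_top)
  qed
qed

text \<open>Exponential decay of the void probability per unit of rescaled height. The quarter comes
  from a region of height \<open>s / 2\<close> over an interval of length \<open>d / 2\<close>, the
  two entries of the minimum from \<open>d = 1\<close> and
  \<open>d = (s / (4 * R)) powr (1 / \<beta>)\<close>. Being defined outside the locale, it visibly
  depends on \<open>\<beta>\<close> and \<open>R\<close> only.\<close>

definition tail_const :: "real \<Rightarrow> real \<Rightarrow> real" where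
  "tail_const \<beta> R = min 1 ((4 * R) powr (- (1 / \<beta>))) / 4"

lemma tail_const_pos: "R > 0 \<Longrightarrow> tail_const \<beta> R > 0"
  by (simp add: tail_const_def)

text \<open>Used with \<open>y\<close> on the boundary: the first part integrates to the norm of
  \<open>g\<close>, the second measures the fluctuation \<open>s\<close>. The bound is
  \<open>\<bar>y + s\<bar> \<le> 2 * max \<bar>y\<bar> s\<close>, and the case distinction follows
  the convention in \<open>Lq_norm_pow\<close>, because \<open>0 powr 0 = 0\<close>.\<close>

lemma score_add_square_le:
  assumes p: "p \<ge> 1" and s: "s > 0"
  shows "(score p (y + s))\<^sup>2 \<le> p\<^sup>2 * 2 powr (2 * p - 2) *
    ((if 2 * p - 2 = 0 then 1 else \<bar>y\<bar> powr (2 * p - 2)) + s powr (2 * p - 2))"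
proof -
  let ?q = "2 * p - 2"
  have "(score p (y + s))\<^sup>2 \<le> p\<^sup>2 * (\<bar>y + s\<bar> powr (p - 1))\<^sup>2"
    by (auto simp: score_def power_mult_distrib sgn_if)
  also have "(\<bar>y + s\<bar> powr (p - 1))\<^sup>2 = \<bar>y + s\<bar> powr ?q"
    by (simp add: power2_eq_square powr_add[symmetric])
  also have "\<bar>y + s\<bar> powr ?q \<le> (2 * max \<bar>y\<bar> s) powr ?q"
    using p s by (intro powr_mono2) auto
  also have "\<dots> = 2 powr ?q * (max \<bar>y\<bar> s) powr ?q"
    using s by (subst powr_mult) auto
  also have "(max \<bar>y\<bar> s) powr ?q \<le> (if ?q = 0 then 1 else \<bar>y\<bar> powr ?q) + s powr ?q"
    using s by (auto simp: max_def)
  finally show ?thesis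
    using p by (simp add: mult_left_mono mult.assoc)
qed

subsection \<open>The intensity measure and void probabilities\<close>

locale boundary_model =
  fixes \<beta> R p :: real and n :: nat and g :: "real \<Rightarrow> real" and P :: "(nat \<Rightarrow> real \<times> real) measure"
  assumes beta: "0 < \<beta>" "\<beta> \<le> 1" and R: "R > 0" and p: "p \<ge> 1" and n: "n \<ge> 1"
    and g: "g \<in> holder_ball \<beta> R" and ppp: "poisson_point_process (ppp_intensity n g) P"
begin

abbreviation \<Lambda> where "\<Lambda> \<equiv> ppp_intensity n g"

sublocale prob_space P
  using ppp by (simp add: poisson_point_process_def)

text \<open>Membership in the Hoelder ball says nothing about \<open>g\<close> outside \<open>[0,1]\<close>, not even measurability;
  \<open>gc\<close> extends it by constants.\<close>

definition gc :: "real \<Rightarrow> real" where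
  "gc x = g (max 0 (min 1 x))"

lemma gc_eq: "x \<in> {0..1} \<Longrightarrow> gc x = g x"
  by (simp add: gc_def)

lemma gc_holder: "\<bar>gc x - gc y\<bar> \<le> R * \<bar>x - y\<bar> powr \<beta>"
proof -
  let ?c = "\<lambda>x::real. max 0 (min 1 x)"
  have "\<bar>gc x - gc y\<bar> \<le> R * \<bar>?c x - ?c y\<bar> powr \<beta>"
    using g by (auto simp: holder_ball_def gc_def)
  also have "\<dots> \<le> R * \<bar>x - y\<bar> powr \<beta>"
    using beta R by (intro mult_left_mono powr_mono2) auto
  finally show ?thesis .
qed

lemma continuous_gc: "continuous_on UNIV gc"
proof (rule continuous_at_imp_continuous_on, intro ballI)
  fix x
  have "((\<lambda>y. R * \<bar>y - x\<bar> powr \<beta>) \<longlongrightarrow> R * \<bar>x - x\<bar> powr \<beta>) (at x)"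
    using beta by (intro tendsto_intros) auto
  then have "((\<lambda>y. R * \<bar>y - x\<bar> powr \<beta>) \<longlongrightarrow> 0) (at x)"
    using beta by simp
  then have "((\<lambda>y. gc y - gc x) \<longlongrightarrow> 0) (at x)"
    by (rule Lim_null_comparison[rotated]) (use gc_holder in auto)
  then show "isCont gc x"
    by (simp add: isCont_def Lim_null[symmetric])
qed

lemma measurable_gc [measurable]: "gc \<in> borel_measurable borel"
  using continuous_gc by (rule borel_measurable_continuous_onI)

lemma gc_bounded: obtains B :: nat where "\<And>x. \<bar>gc x\<bar> \<le> B"
proof -
  have "\<bar>gc x\<bar> \<le> \<bar>gc 0\<bar> + R" for x
  proof -
    have "R * \<bar>max 0 (min 1 x) - 0\<bar> powr \<beta> \<le> R * 1"
      using R beta by (intro mult_left_mono powr_le1) auto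
    moreover have "\<bar>gc (max 0 (min 1 x)) - gc 0\<bar> \<le> R * \<bar>max 0 (min 1 x) - 0\<bar> powr \<beta>"
      by (rule gc_holder)
    moreover have "gc (max 0 (min 1 x)) = gc x" by (simp add: gc_def)
    ultimately show ?thesis by linarith
  qed
  then show ?thesis
    by (intro that[of "nat \<lceil>\<bar>gc 0\<bar> + R\<rceil>"]) (meson of_nat_ceiling order_trans)
qed

lemma space_intensity [simp]: "space \<Lambda> = {0..1} \<times> UNIV"
  by (simp add: ppp_intensity_def space_restrict_space)

lemma sets_intensity: "sets \<Lambda> = sets (restrict_space (borel \<Otimes>\<^sub>M borel) ({0..1} \<times> UNIV))"
  by (simp add: ppp_intensity_def borel_prod cong: sets_restrict_space_cong)

lemma strip_borel: "{0..1::real} \<times> (UNIV :: real set) \<in> sets (borel \<Otimes>\<^sub>M borel)"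
  by measurable

lemma measurable_ident_intensity [measurable]: "(\<lambda>w. w) \<in> \<Lambda> \<rightarrow>\<^sub>M borel \<Otimes>\<^sub>M borel"
  unfolding measurable_cong_sets[OF sets_intensity refl] by (rule measurable_restrict_space1) simp

text \<open>With \<open>gc\<close> in place of \<open>g\<close> the density is Borel on the whole
  plane, which gives access to iterated integrals.\<close>

lemma intensity_eq:
  "\<Lambda> = density (restrict_space lborel ({0..1} \<times> UNIV)) (\<lambda>w. of_nat n * indicator {w. gc (fst w) \<le> snd w} w)"
  unfolding ppp_intensity_def
proof (rule density_cong)
  have eq: "of_nat n * indicator {w. gc (fst w) \<le> snd w} w = (\<lambda>(x, y). of_nat n * indicator {g x..} y :: ennreal) w"
    if "w \<in> {0..1} \<times> UNIV" for w
    using that by (cases w) (auto simp: gc_eq indicator_def)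
  have m: "(\<lambda>w. of_nat n * indicator {w. gc (fst w) \<le> snd w} w :: ennreal) \<in> borel_measurable (borel \<Otimes>\<^sub>M borel)"
    by measurable
  then show "(\<lambda>w. of_nat n * indicator {w. gc (fst w) \<le> snd w} w :: ennreal) \<in> borel_measurable (restrict_space lborel ({0..1} \<times> UNIV))"
    by (intro measurable_restrict_space1) (simp add: borel_prod)
  then show "(\<lambda>(x, y). of_nat n * indicator {g x..} y :: ennreal) \<in> borel_measurable (restrict_space lborel ({0..1} \<times> UNIV))"
    by (rule measurable_cong[THEN iffD1, rotated]) (rule eq, simp add: space_restrict_space)
  show "AE w in restrict_space lborel ({0..1} \<times> UNIV). (\<lambda>(x, y). of_nat n * indicator {g x..} y :: ennreal) w = of_nat n * indicator {w. gc (fst w) \<le> snd w} w"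
    by (intro AE_I2 eq[symmetric]) (simp add: space_restrict_space)
qed

lemma nn_integral_intensity:
  assumes f [measurable]: "f \<in> borel_measurable (borel \<Otimes>\<^sub>M borel)"
  shows "(\<integral>\<^sup>+w. f w \<partial>\<Lambda>) = of_nat n * (\<integral>\<^sup>+x. (\<integral>\<^sup>+y. f (x, y) * indicator {gc x..} y \<partial>lborel) * indicator {0..1} x \<partial>lborel)"
proof -
  have f' [measurable]: "f \<in> borel_measurable (restrict_space lborel ({0..1} \<times> UNIV))"
    using f by (intro measurable_restrict_space1) (simp add: borel_prod)
  have m [measurable]: "(\<lambda>w. of_nat n * indicator {w. gc (fst w) \<le> snd w} w :: ennreal) \<in> borel_measurable (borel \<Otimes>\<^sub>M borel)"
    by measurable
  then have m' [measurable]: "(\<lambda>w. of_nat n * indicator {w. gc (fst w) \<le> snd w} w :: ennreal) \<in> borel_measurable (restrict_space lborel ({0..1} \<times> UNIV))"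
    by (intro measurable_restrict_space1) (simp add: borel_prod)
  have "(\<integral>\<^sup>+w. f w \<partial>\<Lambda>) = (\<integral>\<^sup>+w. of_nat n * indicator {w. gc (fst w) \<le> snd w} w * f w \<partial>restrict_space lborel ({0..1} \<times> UNIV))"
    unfolding intensity_eq by (rule nn_integral_density) measurable
  also have "\<dots> = (\<integral>\<^sup>+w. of_nat n * (indicator {w. gc (fst w) \<le> snd w} w * f w * indicator ({0..1} \<times> UNIV) w) \<partial>lborel)"
    using strip_borel[unfolded borel_prod] by (subst nn_integral_restrict_space) (simp_all add: mult.assoc)
  also have "\<dots> = of_nat n * (\<integral>\<^sup>+w. indicator {w. gc (fst w) \<le> snd w} w * f w * indicator ({0..1} \<times> UNIV) w \<partial>lborel)"
  proof (rule nn_integral_cmult)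
    have "(\<lambda>w. indicator {w. gc (fst w) \<le> snd w} w * f w * indicator ({0..1} \<times> UNIV) w) \<in> borel_measurable (borel \<Otimes>\<^sub>M borel)"
      using strip_borel by measurable
    then show "(\<lambda>w. indicator {w. gc (fst w) \<le> snd w} w * f w * indicator ({0..1} \<times> UNIV) w) \<in> borel_measurable lborel"
      by (simp add: borel_prod)
  qed
  also have "(\<integral>\<^sup>+w. indicator {w. gc (fst w) \<le> snd w} w * f w * indicator ({0..1} \<times> UNIV) w \<partial>lborel)
     = (\<integral>\<^sup>+x. (\<integral>\<^sup>+y. indicator {w. gc (fst w) \<le> snd w} (x, y) * f (x, y) * indicator ({0..1} \<times> UNIV) (x, y) \<partial>lborel) \<partial>lborel)"
  proof -
    have "(\<lambda>w. indicator {w. gc (fst w) \<le> snd w} w * f w * indicator ({0..1} \<times> UNIV) w) \<in> borel_measurable (borel \<Otimes>\<^sub>M borel)"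
      using strip_borel by measurable
    then have "(\<lambda>w. indicator {w. gc (fst w) \<le> snd w} w * f w * indicator ({0..1} \<times> UNIV) w) \<in> borel_measurable (lborel \<Otimes>\<^sub>M lborel)"
      by (simp only: measurable_cong_sets[OF sets_pair_measure_cong[OF sets_lborel sets_lborel] refl])
    from lborel.nn_integral_fst[OF this, symmetric] show ?thesis by (simp only: lborel_prod)
  qed
  also have "\<dots> = (\<integral>\<^sup>+x. (\<integral>\<^sup>+y. f (x, y) * indicator {gc x..} y \<partial>lborel) * indicator {0..1} x \<partial>lborel)"
    by (intro nn_integral_cong) (auto simp: indicator_def intro!: nn_integral_cong)
  finally show ?thesis .
qed

lemma emeasure_intensity:
  assumes A: "A \<in> sets (borel \<Otimes>\<^sub>M borel)"
  shows "emeasure \<Lambda> (A \<inter> space \<Lambda>) = of_nat n * (\<integral>\<^sup>+x. emeasure lborel {y. (x, y) \<in> A \<and> gc x \<le> y} * indicator {0..1} x \<partial>lborel)"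
proof -
  have "A \<inter> space \<Lambda> \<in> sets \<Lambda>"
    unfolding sets_intensity sets_restrict_space using A by auto
  then have "emeasure \<Lambda> (A \<inter> space \<Lambda>) = (\<integral>\<^sup>+w. indicator (A \<inter> space \<Lambda>) w \<partial>\<Lambda>)" by simp
  also have "\<dots> = (\<integral>\<^sup>+w. indicator A w \<partial>\<Lambda>)"
    by (intro nn_integral_cong) (auto simp: indicator_def)
  also have "\<dots> = of_nat n * (\<integral>\<^sup>+x. (\<integral>\<^sup>+y. indicator A (x, y) * indicator {gc x..} y \<partial>lborel) * indicator {0..1} x \<partial>lborel)"
    using A by (intro nn_integral_intensity) simp
  also have "(\<lambda>x. \<integral>\<^sup>+y. indicator A (x, y) * indicator {gc x..} y \<partial>lborel) = (\<lambda>x. emeasure lborel {y. (x, y) \<in> A \<and> gc x \<le> y})"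
  proof
    fix x
    have "{y. (x, y) \<in> A} \<in> sets borel"
      using measurable_sets[of "\<lambda>y. (x, y)" borel "borel \<Otimes>\<^sub>M borel" A] A by (simp add: vimage_def borel_prod)
    then have "{y. (x, y) \<in> A} \<inter> {gc x..} \<in> sets lborel" by auto
    moreover have "(\<integral>\<^sup>+y. indicator A (x, y) * indicator {gc x..} y \<partial>lborel) = (\<integral>\<^sup>+y. indicator ({y. (x, y) \<in> A} \<inter> {gc x..}) y \<partial>lborel)"
      by (intro nn_integral_cong) (auto simp: indicator_def)
    moreover have "{y. (x, y) \<in> A} \<inter> {gc x..} = {y. (x, y) \<in> A \<and> gc x \<le> y}" by auto
    ultimately show "(\<integral>\<^sup>+y. indicator A (x, y) * indicator {gc x..} y \<partial>lborel) = emeasure lborel {y. (x, y) \<in> A \<and> gc x \<le> y}"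
      by simp
  qed
  finally show ?thesis .
qed

lemma sets_intensityI: "Measurable.pred (borel \<Otimes>\<^sub>M borel) Q \<Longrightarrow> {w\<in>space \<Lambda>. Q w} \<in> sets \<Lambda>"
  by (rule predE) (rule measurable_compose[OF measurable_ident_intensity])

text \<open>As \<open>g\<close> is bounded on [0,1], only a bounded region below height
  \<open>M\<close> carries mass. A non-measurable \<open>A\<close> has the default value 0.\<close>

lemma emeasure_intensity_le:
  assumes A: "A \<subseteq> {w. snd w < M}"
  shows "emeasure \<Lambda> A < \<infinity>"
proof -
  have [simp]: "{w\<in>space \<Lambda>. snd w < M} \<in> sets \<Lambda>" by (rule sets_intensityI) measurable
  obtain B :: nat where B: "\<And>x. \<bar>gc x\<bar> \<le> B" by (rule gc_bounded) blast
  have "emeasure \<Lambda> A \<le> emeasure \<Lambda> ({w. snd w < M} \<inter> space \<Lambda>)"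
  proof (cases "A \<in> sets \<Lambda>")
    case True
    then show ?thesis using A sets.sets_into_space[OF True]
      by (intro emeasure_mono) (auto simp: Collect_conj_eq Int_commute)
  qed (simp add: emeasure_notin_sets)
  also have "\<dots> = of_nat n * (\<integral>\<^sup>+x. emeasure lborel {y. (x, y) \<in> {w. snd w < M} \<and> gc x \<le> y} * indicator {0..1} x \<partial>lborel)"
    by (rule emeasure_intensity[OF sets_borel_pairI]) measurable
  also have "\<dots> \<le> of_nat n * (\<integral>\<^sup>+x. ennreal (\<bar>M\<bar> + B) * indicator {0..1::real} x \<partial>lborel)"
  proof (intro mult_left_mono nn_integral_mono mult_right_mono)
    fix x :: real
    have "{y. (x, y) \<in> {w. snd w < M} \<and> gc x \<le> y} \<subseteq> {- real B..\<bar>M\<bar>}" using B[of x] by auto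
    then have "emeasure lborel {y. (x, y) \<in> {w. snd w < M} \<and> gc x \<le> y} \<le> emeasure lborel {- real B..\<bar>M\<bar>}"
      by (rule emeasure_mono) simp
    then show "emeasure lborel {y. (x, y) \<in> {w. snd w < M} \<and> gc x \<le> y} \<le> ennreal (\<bar>M\<bar> + B)"
      by simp
  qed auto
  also have "\<dots> < \<infinity>"
    by (simp add: nn_integral_cmult_indicator ennreal_mult_less_top of_nat_less_top)
  finally show ?thesis .
qed

lemma AE_intensity_above: "AE w in \<Lambda>. gc (fst w) \<le> snd w"
proof (rule AE_I')
  have "emeasure \<Lambda> ({w. snd w < gc (fst w)} \<inter> space \<Lambda>)
      = of_nat n * (\<integral>\<^sup>+x. emeasure lborel {y. (x, y) \<in> {w. snd w < gc (fst w)} \<and> gc x \<le> y} * indicator {0..1} x \<partial>lborel)"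
    by (rule emeasure_intensity[OF sets_borel_pairI]) measurable
  also have "\<dots> = 0"
  proof -
    have eq: "{y. y < gc x \<and> gc x \<le> y} = {}" for x by auto
    show ?thesis by (simp add: eq)
  qed
  finally show "{w. snd w < gc (fst w)} \<inter> space \<Lambda> \<in> null_sets \<Lambda>"
    unfolding null_sets_def sets_intensity sets_restrict_space space_intensity
    by (subst (asm) Int_commute, subst Int_commute) (auto intro!: imageI sets_borel_pairI)
qed auto

section \<open>Points, counts and void events of the process\<close>

lemma sets_P: "sets P = sets (\<Pi>\<^sub>M j\<in>UNIV. \<Lambda>)"
  using ppp by (simp add: poisson_point_process_def)

lemma space_P: "space P = UNIV \<rightarrow>\<^sub>E space \<Lambda>"
  using sets_eq_imp_space_eq[OF sets_P] by (simp add: space_PiM)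

lemma measurable_point_intensity [measurable]: "(\<lambda>\<zeta>. \<zeta> j) \<in> P \<rightarrow>\<^sub>M \<Lambda>"
  unfolding measurable_cong_sets[OF sets_P refl] by (rule measurable_component_singleton) simp

lemma measurable_point [measurable]: "(\<lambda>\<zeta>. \<zeta> j) \<in> P \<rightarrow>\<^sub>M borel \<Otimes>\<^sub>M borel"
  by (rule measurable_compose[OF measurable_point_intensity measurable_ident_intensity])

lemma point_in_space: "\<zeta> \<in> space P \<Longrightarrow> \<zeta> j \<in> space \<Lambda>"
  by (auto simp: space_P)

lemma measurable_num_points: "A \<in> sets \<Lambda> \<Longrightarrow> num_points A \<in> borel_measurable P"
proof -
  assume A: "A \<in> sets \<Lambda>"
  have "num_points A = (\<lambda>\<zeta>. \<Sum>j. indicator A (\<zeta> j))"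
    unfolding num_points_def
  proof
    fix \<zeta> :: "nat \<Rightarrow> real \<times> real"
    have "emeasure (count_space UNIV) {j. \<zeta> j \<in> A} = (\<integral>\<^sup>+j. indicator {j. \<zeta> j \<in> A} j \<partial>count_space UNIV)" by simp
    also have "\<dots> = (\<Sum>j. indicator {j. \<zeta> j \<in> A} j)" by (rule nn_integral_count_space_nat)
    finally show "emeasure (count_space UNIV) {j. \<zeta> j \<in> A} = (\<Sum>j. indicator A (\<zeta> j))"
      by (simp add: indicator_def)
  qed
  moreover have "(\<lambda>\<zeta>. indicator A (\<zeta> j) :: ennreal) \<in> borel_measurable P" for j
    by (rule measurable_compose[OF measurable_point_intensity borel_measurable_indicator[OF A]])
  ultimately show ?thesis by simp
qed

lemma num_points_poisson:
  assumes "A \<in> sets \<Lambda>" "emeasure \<Lambda> A < \<infinity>"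
  shows "prob {\<zeta>\<in>space P. num_points A \<zeta> = of_nat k} = measure \<Lambda> A ^ k / fact k * exp (- measure \<Lambda> A)"
  using assms ppp unfolding poisson_point_process_def by blast

lemma indep_num_points:
  fixes A :: "nat \<Rightarrow> (real \<times> real) set"
  assumes "\<And>i. A i \<in> sets \<Lambda>" "disjoint_family A"
  shows "indep_vars (\<lambda>_. borel) (\<lambda>i. num_points (A i)) UNIV"
  using assms ppp unfolding poisson_point_process_def by blast

lemma num_points_eq_0: "num_points A \<zeta> = 0 \<longleftrightarrow> (\<forall>j. \<zeta> j \<notin> A)"
  unfolding num_points_def by (subst emeasure_count_space_eq_0) auto

lemma num_points_finite: "num_points A \<zeta> = of_nat k \<Longrightarrow> finite {j. \<zeta> j \<in> A}"
  unfolding num_points_def by (cases "finite {j. \<zeta> j \<in> A}") auto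

lemma enn2real_num_points: "finite {j. \<zeta> j \<in> A} \<Longrightarrow> enn2real (num_points A \<zeta>) = card {j. \<zeta> j \<in> A}"
  unfolding num_points_def by simp

lemma AE_finite_points:
  assumes "A \<in> sets \<Lambda>" "emeasure \<Lambda> A < \<infinity>"
  shows "AE \<zeta> in P. finite {j. \<zeta> j \<in> A}"
  using poisson_moments(1)[OF measurable_num_points[OF assms(1)] num_points_poisson[OF assms]]
  by eventually_elim (auto dest: num_points_finite)

lemma prob_void:
  assumes A: "A \<in> sets \<Lambda>" "emeasure \<Lambda> A < \<infinity>"
  shows "prob {\<zeta>\<in>space P. \<forall>j. \<zeta> j \<notin> A} = exp (- measure \<Lambda> A)"
  using num_points_poisson[OF A, of 0] by (simp add: num_points_eq_0)

text \<open>The almost sure event on which all pathwise arguments run. Natural heights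
  \<open>M\<close> make it a countable intersection, and membership in
  \<open>space \<Lambda>\<close> is included so that these arguments need not mention
  \<open>space P\<close>.\<close>

definition good :: "(nat \<Rightarrow> real \<times> real) \<Rightarrow> bool" where
  "good \<zeta> \<longleftrightarrow> (\<forall>j. \<zeta> j \<in> space \<Lambda> \<and> gc (fst (\<zeta> j)) \<le> snd (\<zeta> j)) \<and> (\<forall>M::nat. finite {j. snd (\<zeta> j) < M})"

text \<open>The region below the boundary has intensity 0, hence void probability
  \<open>exp 0 = 1\<close>; a region of bounded height has finite intensity, hence an almost surely
  finite Poisson count.\<close>

lemma AE_good: "AE \<zeta> in P. good \<zeta>"
proof -
  let ?A = "{w\<in>space \<Lambda>. snd w < gc (fst w)}"
  have A: "?A \<in> sets \<Lambda>" by (rule sets_intensityI) measurable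
  have "emeasure \<Lambda> ?A = 0"
    using AE_intensity_above by (subst (asm) AE_iff_measurable[OF A]) (auto simp: not_le)
  then have "prob {\<zeta>\<in>space P. \<forall>j. \<zeta> j \<notin> ?A} = 1"
    using prob_void[OF A] by (simp add: measure_def)
  then have 1: "AE \<zeta> in P. \<forall>j. \<zeta> j \<notin> ?A"
    using prob_eq_1[of "{\<zeta>\<in>space P. \<forall>j. \<zeta> j \<notin> ?A}"] A by (auto elim: AE_mp)
  have 2: "AE \<zeta> in P. \<forall>M::nat. finite {j. \<zeta> j \<in> {w\<in>space \<Lambda>. snd w < M}}"
    unfolding AE_all_countable
  proof
    fix M :: nat
    have "{w\<in>space \<Lambda>. snd w < M} \<in> sets \<Lambda>" by (rule sets_intensityI) measurable
    then show "AE \<zeta> in P. finite {j. \<zeta> j \<in> {w\<in>space \<Lambda>. snd w < M}}"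
      by (rule AE_finite_points) (rule emeasure_intensity_le[of _ M], auto)
  qed
  show ?thesis
    using 1 2 AE_space
  proof eventually_elim
    case (elim \<zeta>)
    then have "\<zeta> j \<in> space \<Lambda>" for j by (intro point_in_space)
    with elim show ?case unfolding good_def by (auto simp: not_less)
  qed
qed

text \<open>Phrased through \<open>below\<close> and not through \<open>mle\<close>, this is a void
  event with explicit probability. A point of the process never hides itself, since
  \<open>below\<close> is strict, so the definition also applies at
  \<open>w = \<zeta> j\<close>.\<close>

definition visible :: "(nat \<Rightarrow> real \<times> real) \<Rightarrow> real \<times> real \<Rightarrow> bool" where
  "visible \<zeta> w \<longleftrightarrow> (\<forall>j. \<not> below \<beta> R w (\<zeta> j))"

lemma measurable_visible [measurable]: "Measurable.pred (P \<Otimes>\<^sub>M \<Lambda>) (\<lambda>x. visible (fst x) (snd x))"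
  unfolding visible_def by measurable

lemma measurable_visible_borel [measurable]: "Measurable.pred (P \<Otimes>\<^sub>M (borel \<Otimes>\<^sub>M borel)) (\<lambda>x. visible (fst x) (snd x))"
  unfolding visible_def by measurable

lemma prob_visible:
  "prob {\<zeta>\<in>space P. visible \<zeta> w} = exp (- measure \<Lambda> {v\<in>space \<Lambda>. below \<beta> R w v})"
proof -
  have "{\<zeta>\<in>space P. visible \<zeta> w} = {\<zeta>\<in>space P. \<forall>j. \<zeta> j \<notin> {v\<in>space \<Lambda>. below \<beta> R w v}}"
    using point_in_space by (auto simp: visible_def)
  moreover have "{v\<in>space \<Lambda>. below \<beta> R w v} \<subseteq> {v. snd v < snd w}"
    unfolding below_def using R by (auto intro: le_less_trans[rotated])
  then have "emeasure \<Lambda> {v\<in>space \<Lambda>. below \<beta> R w v} < \<infinity>" by (rule emeasure_intensity_le)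
  moreover have "{v\<in>space \<Lambda>. below \<beta> R w v} \<in> sets \<Lambda>"
    by (rule sets_intensityI) (rule measurable_below[OF measurable_const measurable_ident_borel_pair], simp add: space_pair_measure)
  ultimately show ?thesis by (simp only: prob_void)
qed

subsection \<open>Dyadic discretization\<close>

lemma sigma_finite_intensity: "sigma_finite_measure \<Lambda>"
proof
  let ?A = "(\<lambda>M::nat. {w\<in>space \<Lambda>. snd w < M}) ` UNIV"
  have "?A \<subseteq> sets \<Lambda>" by (intro image_subsetI sets_intensityI) measurable
  moreover have "\<forall>a\<in>?A. emeasure \<Lambda> a \<noteq> \<infinity>"
  proof
    fix a assume "a \<in> ?A"
    then obtain M :: nat where "a = {w\<in>space \<Lambda>. snd w < M}" by auto
    then have "emeasure \<Lambda> a < \<infinity>" by (intro emeasure_intensity_le[of _ M]) auto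
    then show "emeasure \<Lambda> a \<noteq> \<infinity>" by simp
  qed
  moreover have "\<Union> ?A = space \<Lambda>"
  proof (intro equalityI subsetI)
    fix w assume "w \<in> space \<Lambda>"
    moreover obtain M :: nat where "snd w < M" using reals_Archimedean2 by blast
    ultimately show "w \<in> \<Union> ?A" by auto
  qed auto
  ultimately show "\<exists>A. countable A \<and> A \<subseteq> sets \<Lambda> \<and> \<Union> A = space \<Lambda> \<and> (\<forall>a\<in>A. emeasure \<Lambda> a \<noteq> \<infinity>)"
    by (intro exI[of _ ?A]) auto
qed

sublocale intensity: sigma_finite_measure \<Lambda>
  by (rule sigma_finite_intensity)

text \<open>Cells are coded by naturals because the independence of counts is stated for sequences
  of disjoint sets.\<close>

definition cell_of :: "nat \<Rightarrow> real \<times> real \<Rightarrow> nat" where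
  "cell_of m w = to_nat (\<lfloor>2 ^ m * fst w\<rfloor>, \<lfloor>2 ^ m * snd w\<rfloor>)"

definition cell :: "nat \<Rightarrow> nat \<Rightarrow> (real \<times> real) set" where
  "cell m i = {w\<in>space \<Lambda>. cell_of m w = i}"

text \<open>The additional column \<open>2 ^ m\<close> holds the points with first coordinate
  1.\<close>

definition cells :: "nat \<Rightarrow> nat \<Rightarrow> nat set" where
  "cells M m = to_nat ` ({0..2 ^ m :: int} \<times> {- (int M * 2 ^ m)..<int M * 2 ^ m})"

text \<open>The cut in height makes the intensity finite and leaves finitely many cells.\<close>

definition strip :: "nat \<Rightarrow> (real \<times> real) set" where
  "strip M = {w\<in>space \<Lambda>. - real M \<le> snd w \<and> snd w < real M}"

text \<open>Asking for all pairs of points keeps the relation between cells asymmetric, as the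
  second moment identity requires. Cells that meet the region only in part are left out; what they
  hide is recovered on finer grids.\<close>

definition lower_cells :: "nat \<Rightarrow> nat \<Rightarrow> nat \<Rightarrow> nat set" where
  "lower_cells M m i = {k\<in>cells M m. \<forall>z\<in>cell m i. \<forall>w\<in>cell m k. below \<beta> R z w}"

text \<open>The score at the lower edge of the cell, so that summands depend on the cell
  alone.\<close>

definition cell_score :: "nat \<Rightarrow> nat \<Rightarrow> real" where
  "cell_score m i = score p (snd (from_nat i :: int \<times> int) / 2 ^ m)"

definition N :: "nat \<Rightarrow> nat \<Rightarrow> (nat \<Rightarrow> real \<times> real) \<Rightarrow> real" where
  "N m i \<zeta> = enn2real (num_points (cell m i) \<zeta>)"

text \<open>Discrete version of the indicator of \<open>visible\<close>, with the region below a point replaced by the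
  cells that lie entirely below every point of its cell.\<close>

definition empty_below :: "nat \<Rightarrow> nat \<Rightarrow> (nat \<Rightarrow> real \<times> real) \<Rightarrow> nat \<Rightarrow> real" where
  "empty_below M m \<zeta> i = (\<Prod>k\<in>lower_cells M m i. of_bool (N m k \<zeta> = 0))"

definition grid_error :: "nat \<Rightarrow> nat \<Rightarrow> (nat \<Rightarrow> real \<times> real) \<Rightarrow> real" where
  "grid_error M m \<zeta> = (\<Sum>i\<in>cells M m. cell_score m i * (N m i \<zeta> - measure \<Lambda> (cell m i)) * empty_below M m \<zeta> i)"

lemma finite_cells [simp]: "finite (cells M m)"
  by (simp add: cells_def)

lemma measurable_cell_of [measurable]: "cell_of m \<in> \<Lambda> \<rightarrow>\<^sub>M count_space UNIV"
proof (subst measurable_count_space_eq_countable, simp, intro conjI ballI)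
  fix i :: nat
  \<comment> \<open>The last condition makes the set empty for an \<open>i\<close> that codes no
    pair.\<close>
  have eq: "cell_of m -` {i} \<inter> space \<Lambda> = {w\<in>space \<Lambda>. \<lfloor>2 ^ m * fst w\<rfloor> = fst (from_nat i :: int \<times> int) \<and>
      \<lfloor>2 ^ m * snd w\<rfloor> = snd (from_nat i :: int \<times> int) \<and> to_nat (from_nat i :: int \<times> int) = i}"
    unfolding cell_of_def by (auto simp del: space_intensity)
  show "cell_of m -` {i} \<inter> space \<Lambda> \<in> sets \<Lambda>"
    unfolding eq by (rule sets_intensityI) measurable
qed simp

lemma cell_sets [measurable]: "cell m i \<in> sets \<Lambda>"
  unfolding cell_def by measurable

lemma strip_sets [measurable]: "strip M \<in> sets \<Lambda>"
  unfolding strip_def by (rule sets_intensityI) measurable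

lemma strip_finite: "emeasure \<Lambda> (strip M) < \<infinity>"
  by (rule emeasure_intensity_le[of _ M]) (auto simp: strip_def)

text \<open>The levels \<open>- M\<close> and \<open>M\<close> are grid lines at every resolution,
  so the cells fill the strip exactly and no edge effects arise.\<close>

lemma cell_of_in_cells: "w \<in> space \<Lambda> \<Longrightarrow> cell_of m w \<in> cells M m \<longleftrightarrow> w \<in> strip M"
proof -
  assume w: "w \<in> space \<Lambda>"
  have pos: "(0::real) < 2 ^ m" by simp
  have "cell_of m w \<in> cells M m \<longleftrightarrow> (\<lfloor>2 ^ m * fst w\<rfloor>, \<lfloor>2 ^ m * snd w\<rfloor>) \<in> {0..2 ^ m :: int} \<times> {- (int M * 2 ^ m)..<int M * 2 ^ m}"
    unfolding cells_def cell_of_def by (rule inj_image_mem_iff) (rule inj_to_nat)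
  also have "\<dots> \<longleftrightarrow> - (int M * 2 ^ m) \<le> \<lfloor>2 ^ m * snd w\<rfloor> \<and> \<lfloor>2 ^ m * snd w\<rfloor> < int M * 2 ^ m"
  proof -
    have "0 \<le> \<lfloor>2 ^ m * fst w\<rfloor>" using w by auto
    moreover have "2 ^ m * fst w \<le> 2 ^ m * 1" using w by (intro mult_left_mono) auto
    then have "2 ^ m * fst w < 2 ^ m + 1" unfolding mult_1_right by (rule le_less_trans) simp
    then have "\<lfloor>2 ^ m * fst w\<rfloor> \<le> 2 ^ m" by (simp add: floor_le_iff)
    ultimately show ?thesis by auto
  qed
  also have "\<dots> \<longleftrightarrow> 2 ^ m * (- real M) \<le> 2 ^ m * snd w \<and> 2 ^ m * snd w < 2 ^ m * real M"
    by (simp add: le_floor_iff floor_less_iff mult.commute)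
  also have "\<dots> \<longleftrightarrow> w \<in> strip M"
    using w unfolding strip_def by (simp only: mult_le_cancel_left_pos[OF pos] mult_less_cancel_left_pos[OF pos]) simp
  finally show ?thesis .
qed

lemma cell_subset_strip: "i \<in> cells M m \<Longrightarrow> cell m i \<subseteq> strip M"
  using cell_of_in_cells by (auto simp: cell_def simp del: space_intensity)

text \<open>For an empty cell the condition in \<open>lower_cells\<close> would hold vacuously in
  both directions and spoil asymmetry. The lower left corner is a witness, even in the column over
  1.\<close>

lemma cell_nonempty: "i \<in> cells M m \<Longrightarrow> cell m i \<noteq> {}"
proof -
  assume "i \<in> cells M m"
  then obtain a b :: int where i: "i = to_nat (a, b)" "0 \<le> a" "a \<le> 2 ^ m" by (auto simp: cells_def)
  have "real_of_int a \<le> 2 ^ m" using i(3) by (metis of_int_le_iff of_int_numeral of_int_power)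
  then have "(a / 2 ^ m, b / 2 ^ m) \<in> cell m i"
    using i by (auto simp: cell_def cell_of_def)
  then show ?thesis by blast
qed

lemma lower_cells_subset: "lower_cells M m i \<subseteq> cells M m"
  by (auto simp: lower_cells_def)

lemma lower_cells_asym:
  assumes "i \<in> cells M m" "j \<in> cells M m" "i \<in> lower_cells M m j"
  shows "j \<notin> lower_cells M m i"
proof
  assume j: "j \<in> lower_cells M m i"
  obtain z w where z: "z \<in> cell m i" and w: "w \<in> cell m j"
    using cell_nonempty assms by blast
  then have "below \<beta> R z w" "below \<beta> R w z"
    using assms(3) j by (auto simp: lower_cells_def)
  then have "snd w + R * \<bar>fst z - fst w\<bar> powr \<beta> < snd z" "snd z + R * \<bar>fst w - fst z\<bar> powr \<beta> < snd w"
    by (auto simp: below_def)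
  moreover have "0 \<le> R * \<bar>fst z - fst w\<bar> powr \<beta>" "0 \<le> R * \<bar>fst w - fst z\<bar> powr \<beta>" using R by auto
  ultimately show False by linarith
qed

lemma measurable_N [measurable]: "N m i \<in> borel_measurable P"
  using measurable_num_points[OF cell_sets[of m i]] unfolding N_def by simp

lemma indep_N: "indep_vars (\<lambda>_. borel) (N m) (cells M m)"
proof -
  have "indep_vars (\<lambda>_. borel) (\<lambda>i. num_points (cell m i)) UNIV"
    by (rule indep_num_points[OF cell_sets]) (auto simp: disjoint_family_on_def cell_def)
  then have "indep_vars (\<lambda>_. borel) (\<lambda>i \<zeta>. enn2real (num_points (cell m i) \<zeta>)) UNIV"
    by (rule indep_vars_compose2) simp
  then show ?thesis unfolding N_def by (rule indep_vars_subset) simp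
qed

lemma cell_finite: "i \<in> cells M m \<Longrightarrow> emeasure \<Lambda> (cell m i) < \<infinity>"
  by (rule le_less_trans[OF emeasure_mono[OF cell_subset_strip strip_sets] strip_finite])

lemma grid_error_moments:
  "integrable P (\<lambda>\<zeta>. (grid_error M m \<zeta>)\<^sup>2)" "expectation (grid_error M m) = 0"
  "expectation (\<lambda>\<zeta>. (grid_error M m \<zeta>)\<^sup>2) =
    (\<Sum>i\<in>cells M m. (cell_score m i)\<^sup>2 * measure \<Lambda> (cell m i) * expectation (\<lambda>\<zeta>. empty_below M m \<zeta> i))"
proof -
  note mom = poisson_moments[OF measurable_num_points[OF cell_sets] num_points_poisson[OF cell_sets cell_finite], folded N_def]
  note S = compensated_void_sum[where Q = "cells M m" and N = "N m" and l = "\<lambda>i. measure \<Lambda> (cell m i)"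
      and d = "lower_cells M m" and c = "cell_score m",
      OF finite_cells indep_N mom(2) mom(3) mom(4) mom(5) lower_cells_subset lower_cells_asym,
      folded empty_below_def grid_error_def]
  show "integrable P (\<lambda>\<zeta>. (grid_error M m \<zeta>)\<^sup>2)" "expectation (grid_error M m) = 0"
    "expectation (\<lambda>\<zeta>. (grid_error M m \<zeta>)\<^sup>2) =
    (\<Sum>i\<in>cells M m. (cell_score m i)\<^sup>2 * measure \<Lambda> (cell m i) * expectation (\<lambda>\<zeta>. empty_below M m \<zeta> i))"
    using S by (simp_all only: grid_error_def[abs_def])
qed

section \<open>From the grid to the strip\<close>

lemma eventually_below_cells:
  assumes zw: "below \<beta> R z w"
  shows "\<forall>\<^sub>F m in sequentially. \<forall>z'\<in>cell m (cell_of m z). \<forall>w'\<in>cell m (cell_of m w). below \<beta> R z' w'"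
proof -
  have close: "\<bar>fst v' - fst v\<bar> \<le> (1 / 2) ^ m \<and> \<bar>snd v' - snd v\<bar> \<le> (1 / 2) ^ m"
    if "v' \<in> cell m (cell_of m v)" for v v' :: "real \<times> real" and m
  proof -
    have fl: "\<bar>a - b\<bar> \<le> (1 / 2) ^ m" if "\<lfloor>2 ^ m * a\<rfloor> = \<lfloor>2 ^ m * b\<rfloor>" for a b :: real
    proof -
      have "\<bar>2 ^ m * a - 2 ^ m * b\<bar> \<le> 1" using that by linarith
      then have "\<bar>2 ^ m * (a - b)\<bar> \<le> 1" by (simp add: right_diff_distrib)
      then have "2 ^ m * \<bar>a - b\<bar> \<le> 1" by (simp add: abs_mult)
      then show ?thesis by (simp add: power_divide field_simps)
    qed
    show ?thesis using that by (auto simp: cell_def cell_of_def intro!: fl)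
  qed
  \<comment> \<open>\<open>below\<close> is an open condition. Each of the two points moves by at
    most \<open>(1 / 2) ^ m\<close> in each coordinate; the terms \<open>2 * (1 / 2) ^ m\<close>
    cover both moves together.\<close>
  let ?\<phi> = "\<lambda>m::nat. snd w + 2 * (1 / 2) ^ m + R * (\<bar>fst z - fst w\<bar> + 2 * (1 / 2) ^ m) powr \<beta>"
  have h0: "(\<lambda>m. 2 * (1 / 2 :: real) ^ m) \<longlonglongrightarrow> 0"
    by (rule tendsto_mult_right_zero LIMSEQ_power_zero | simp)+
  have "?\<phi> \<longlonglongrightarrow> snd w + 0 + R * (\<bar>fst z - fst w\<bar> + 0) powr \<beta>"
    using beta by (intro tendsto_intros tendsto_powr' h0) auto
  moreover have "snd w + 0 + R * (\<bar>fst z - fst w\<bar> + 0) powr \<beta> < snd z"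
    using zw by (simp add: below_def)
  ultimately have "\<forall>\<^sub>F m in sequentially. ?\<phi> m < snd z"
    by (rule order_tendstoD(2))
  then show ?thesis
  proof eventually_elim
    case (elim m)
    show ?case
    proof (intro ballI)
      fix z' w' assume "z' \<in> cell m (cell_of m z)" "w' \<in> cell m (cell_of m w)"
      note c = close[OF this(1)] close[OF this(2)]
      have "R * \<bar>fst z' - fst w'\<bar> powr \<beta> \<le> R * (\<bar>fst z - fst w\<bar> + 2 * (1 / 2) ^ m) powr \<beta>"
        using R beta c by (intro mult_left_mono powr_mono2) auto
      then show "below \<beta> R z' w'"
        unfolding below_def using elim c by (simp add: abs_le_iff)
    qed
  qed
qed

lemma good_strip:
  assumes "good \<zeta>" and M: "\<And>x. \<bar>gc x\<bar> \<le> M"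
  shows "\<zeta> j \<in> strip M \<longleftrightarrow> snd (\<zeta> j) < M"
proof -
  have "\<zeta> j \<in> space \<Lambda>" "gc (fst (\<zeta> j)) \<le> snd (\<zeta> j)" using assms(1) by (simp_all add: good_def)
  moreover from this have "- real M \<le> snd (\<zeta> j)" using M[of "fst (\<zeta> j)"] by linarith
  ultimately show ?thesis by (simp add: strip_def)
qed

lemma good_finite_cell:
  assumes "good \<zeta>" "i \<in> cells M m"
  shows "finite {j. \<zeta> j \<in> cell m i}"
proof -
  have "finite {j. snd (\<zeta> j) < M}" using assms by (auto simp: good_def)
  then show ?thesis
    by (rule finite_subset[rotated]) (use cell_subset_strip[OF assms(2)] in \<open>auto simp: strip_def\<close>)
qed

lemma empty_below_eq:
  assumes \<zeta>: "good \<zeta>"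
  shows "empty_below M m \<zeta> i = of_bool (\<forall>j. cell_of m (\<zeta> j) \<notin> lower_cells M m i)"
proof -
  have fin: "finite (lower_cells M m i)" by (rule finite_subset[OF lower_cells_subset]) simp
  have "N m k \<zeta> = 0 \<longleftrightarrow> (\<forall>j. cell_of m (\<zeta> j) \<noteq> k)" if "k \<in> lower_cells M m i" for k
  proof -
    have "k \<in> cells M m" using that lower_cells_subset by blast
    from good_finite_cell[OF \<zeta> this] have "N m k \<zeta> = card {j. \<zeta> j \<in> cell m k}" "finite {j. \<zeta> j \<in> cell m k}"
      by (simp_all add: N_def enn2real_num_points)
    then show ?thesis using \<zeta> by (auto simp: cell_def good_def simp del: space_intensity)
  qed
  then have "empty_below M m \<zeta> i = (\<Prod>k\<in>lower_cells M m i. of_bool (\<forall>j. cell_of m (\<zeta> j) \<noteq> k))"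
    unfolding empty_below_def by (intro prod.cong) auto
  also have "\<dots> = of_bool (\<forall>j. cell_of m (\<zeta> j) \<notin> lower_cells M m i)"
  proof (cases "\<forall>j. cell_of m (\<zeta> j) \<notin> lower_cells M m i")
    case True
    then have "(\<Prod>k\<in>lower_cells M m i. of_bool (\<forall>j. cell_of m (\<zeta> j) \<noteq> k) :: real) = (\<Prod>k\<in>lower_cells M m i. 1)"
      by (intro prod.cong) auto
    then show ?thesis using True by simp
  next
    case False
    then obtain j where "cell_of m (\<zeta> j) \<in> lower_cells M m i" by blast
    then have "(\<Prod>k\<in>lower_cells M m i. of_bool (\<forall>j. cell_of m (\<zeta> j) \<noteq> k) :: real) = 0"
      using fin by (intro prod_zero) auto
    then show ?thesis using False by simp
  qed
  finally show ?thesis .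
qed

text \<open>The sequence is eventually constant. If \<open>w\<close> is visible, no point can occupy
  a lower cell at any resolution, since such a cell lies inside the region below \<open>w\<close>.
  Otherwise a point hiding \<open>w\<close> eventually sits in a lower cell.\<close>

lemma tendsto_empty_below:
  assumes \<zeta>: "good \<zeta>" and M: "\<And>x. \<bar>gc x\<bar> \<le> M" and w: "w \<in> strip M"
  shows "(\<lambda>m. empty_below M m \<zeta> (cell_of m w)) \<longlonglongrightarrow> of_bool (visible \<zeta> w)"
proof (rule tendsto_eventually)
  have in_cell: "v \<in> space \<Lambda> \<Longrightarrow> v \<in> cell m (cell_of m v)" for v m by (simp add: cell_def)
  show "\<forall>\<^sub>F m in sequentially. empty_below M m \<zeta> (cell_of m w) = of_bool (visible \<zeta> w)"
  proof (cases "visible \<zeta> w")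
    case True
    have "cell_of m (\<zeta> j) \<notin> lower_cells M m (cell_of m w)" for m j
    proof
      assume "cell_of m (\<zeta> j) \<in> lower_cells M m (cell_of m w)"
      then have "below \<beta> R w (\<zeta> j)"
        unfolding lower_cells_def using w \<zeta> in_cell by (auto simp: strip_def good_def simp del: space_intensity)
      then show False using True by (simp add: visible_def)
    qed
    then show ?thesis using True by (simp add: empty_below_eq[OF \<zeta>])
  next
    case False
    then obtain j where j: "below \<beta> R w (\<zeta> j)" by (auto simp: visible_def)
    have "0 \<le> R * \<bar>fst w - fst (\<zeta> j)\<bar> powr \<beta>" using R by simp
    then have "snd (\<zeta> j) < M" using j w unfolding below_def strip_def by simp
    then have "\<zeta> j \<in> strip M" using good_strip[OF \<zeta> M] by blast
    then have cj: "cell_of m (\<zeta> j) \<in> cells M m" for m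
      using cell_of_in_cells by (simp add: strip_def del: space_intensity)
    from eventually_below_cells[OF j] have "\<forall>\<^sub>F m in sequentially. cell_of m (\<zeta> j) \<in> lower_cells M m (cell_of m w)"
      by eventually_elim (use cj in \<open>auto simp: lower_cells_def\<close>)
    then show ?thesis
      by eventually_elim (use False in \<open>auto simp: empty_below_eq[OF \<zeta>]\<close>)
  qed
qed

lemma cell_score_cell_of: "cell_score m (cell_of m w) = score p (\<lfloor>2 ^ m * snd w\<rfloor> / 2 ^ m)"
  by (simp add: cell_score_def cell_of_def)

lemma abs_cell_score_le:
  assumes "w \<in> strip M" "0 < M"
  shows "\<bar>cell_score m (cell_of m w)\<bar> \<le> p * M powr (p - 1)"
  unfolding cell_score_cell_of
proof (rule abs_score_le[OF p])
  have "2 ^ m * (- real M) \<le> 2 ^ m * snd w" "2 ^ m * snd w < 2 ^ m * real M"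
    using assms by (intro mult_left_mono mult_strict_left_mono; simp add: strip_def)+
  then have "- (int M * 2 ^ m) \<le> \<lfloor>2 ^ m * snd w\<rfloor>" "\<lfloor>2 ^ m * snd w\<rfloor> < int M * 2 ^ m"
    by (simp_all add: le_floor_iff floor_less_iff mult.commute)
  then have "\<bar>\<lfloor>2 ^ m * snd w\<rfloor>\<bar> \<le> int M * 2 ^ m" by linarith
  then have "real_of_int \<bar>\<lfloor>2 ^ m * snd w\<rfloor>\<bar> \<le> real_of_int (int M * 2 ^ m)" by (simp only: of_int_le_iff)
  then show "\<bar>\<lfloor>2 ^ m * snd w\<rfloor> / 2 ^ m\<bar> \<le> real M" by (simp add: abs_divide pos_divide_le_eq)
qed (use assms in simp)

lemma integral_cells:
  fixes f :: "nat \<Rightarrow> real"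
  shows "(\<integral>w. indicator (strip M) w * f (cell_of m w) \<partial>\<Lambda>) = (\<Sum>i\<in>cells M m. f i * measure \<Lambda> (cell m i))"
proof -
  have "(\<integral>w. indicator (strip M) w * f (cell_of m w) \<partial>\<Lambda>) = (\<integral>w. (\<Sum>i\<in>cells M m. f i * indicator (cell m i) w) \<partial>\<Lambda>)"
  proof (rule Bochner_Integration.integral_cong[OF refl])
    fix w assume w: "w \<in> space \<Lambda>"
    have "(\<Sum>i\<in>cells M m. f i * indicator (cell m i) w) = (\<Sum>i\<in>cells M m. if i = cell_of m w then f i else 0)"
      using w by (intro sum.cong) (auto simp: cell_def indicator_def simp del: space_intensity)
    then show "indicator (strip M) w * f (cell_of m w) = (\<Sum>i\<in>cells M m. f i * indicator (cell m i) w)"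
      using cell_of_in_cells[OF w, of m M] by (simp add: sum.delta')
  qed
  also have "\<dots> = (\<Sum>i\<in>cells M m. f i * measure \<Lambda> (cell m i))"
    using cell_finite sets.sets_into_space[OF cell_sets]
    by (subst Bochner_Integration.integral_sum) (auto simp: Int_absorb2 simp del: space_intensity)
  finally show ?thesis .
qed

lemma sum_cells:
  fixes f :: "nat \<Rightarrow> real"
  assumes \<zeta>: "good \<zeta>" and M: "\<And>x. \<bar>gc x\<bar> \<le> M"
  shows "(\<Sum>i\<in>cells M m. f i * N m i \<zeta>) = (\<Sum>j | snd (\<zeta> j) < M. f (cell_of m (\<zeta> j)))"
proof -
  let ?J = "{j. snd (\<zeta> j) < M}"
  have sp: "\<zeta> j \<in> space \<Lambda>" for j using \<zeta> by (simp add: good_def)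
  have fin: "finite ?J" using \<zeta> by (auto simp: good_def)
  have "(\<Sum>j\<in>?J. f (cell_of m (\<zeta> j))) = (\<Sum>i\<in>cells M m. \<Sum>j\<in>{j\<in>?J. cell_of m (\<zeta> j) = i}. f (cell_of m (\<zeta> j)))"
    using fin cell_of_in_cells[OF sp] good_strip[OF \<zeta> M] by (intro sum.group[symmetric]) auto
  also have "\<dots> = (\<Sum>i\<in>cells M m. f i * N m i \<zeta>)"
  proof (rule sum.cong[OF refl])
    fix i assume i: "i \<in> cells M m"
    have "{j\<in>?J. cell_of m (\<zeta> j) = i} = {j. \<zeta> j \<in> cell m i}"
      using i cell_of_in_cells[OF sp] good_strip[OF \<zeta> M] sp by (auto simp: cell_def simp del: space_intensity)
    then show "(\<Sum>j\<in>{j\<in>?J. cell_of m (\<zeta> j) = i}. f (cell_of m (\<zeta> j))) = f i * N m i \<zeta>"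
      using good_finite_cell[OF \<zeta> i] by (simp add: N_def enn2real_num_points cell_def mult.commute)
  qed
  finally show ?thesis ..
qed

text \<open>The compensated sum \<open>T\<close> cut at height \<open>M\<close>. On good
  configurations the lower edge of the strip is inactive once \<open>M\<close> bounds
  \<open>\<bar>g\<bar>\<close>, so the sum mentions the upper edge only.\<close>

definition strip_error :: "nat \<Rightarrow> (nat \<Rightarrow> real \<times> real) \<Rightarrow> real" where
  "strip_error M \<zeta> = (\<Sum>j. of_bool (snd (\<zeta> j) < M) * (score p (snd (\<zeta> j)) * of_bool (visible \<zeta> (\<zeta> j))))
     - (\<integral>w. indicator (strip M) w * (score p (snd w) * of_bool (visible \<zeta> w)) \<partial>\<Lambda>)"

text \<open>In martingale terms, the counterpart of the predictable quadratic variation of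
  \<open>T\<close>.\<close>

definition strip_var :: "nat \<Rightarrow> (nat \<Rightarrow> real \<times> real) \<Rightarrow> real" where
  "strip_var M \<zeta> = (\<integral>w. indicator (strip M) w * ((score p (snd w))\<^sup>2 * of_bool (visible \<zeta> w)) \<partial>\<Lambda>)"

lemma measurable_strip_error [measurable]: "strip_error M \<in> borel_measurable P"
proof -
  have [measurable]: "Measurable.pred P (\<lambda>\<zeta>. visible \<zeta> (\<zeta> j))" for j
    unfolding visible_def by measurable
  have "(\<lambda>\<zeta>. \<integral>w. indicator (strip M) w * (score p (snd w) * of_bool (visible \<zeta> w)) \<partial>\<Lambda>) \<in> borel_measurable P"
    by (rule intensity.borel_measurable_lebesgue_integral) (simp add: split_beta', measurable)
  then show ?thesis
    unfolding strip_error_def by (intro borel_measurable_diff borel_measurable_suminf) measurable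
qed

lemma measurable_strip_var [measurable]: "strip_var M \<in> borel_measurable P"
  unfolding strip_var_def
  by (rule intensity.borel_measurable_lebesgue_integral) (simp add: split_beta', measurable)

lemma empty_below_bounds: "0 \<le> empty_below M m \<zeta> i" "empty_below M m \<zeta> i \<le> 1"
  unfolding empty_below_def by (auto intro!: prod_nonneg prod_le_1)

text \<open>Applied with \<open>f\<close> the identity for the compensator and with the square for
  the variance. Monotonicity in modulus turns the bound on the score into a dominating
  constant.\<close>

lemma tendsto_cell_integral:
  fixes f :: "real \<Rightarrow> real"
  assumes \<zeta>: "good \<zeta>" and M: "\<And>x. \<bar>gc x\<bar> \<le> M" "0 < M" and f: "continuous_on UNIV f" "\<And>x y. \<bar>x\<bar> \<le> \<bar>y\<bar> \<Longrightarrow> \<bar>f x\<bar> \<le> \<bar>f y\<bar>"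
  shows "(\<lambda>m. \<integral>w. indicator (strip M) w * (f (cell_score m (cell_of m w)) * empty_below M m \<zeta> (cell_of m w)) \<partial>\<Lambda>)
    \<longlonglongrightarrow> (\<integral>w. indicator (strip M) w * (f (score p (snd w)) * of_bool (visible \<zeta> w)) \<partial>\<Lambda>)"
proof (rule integral_dominated_convergence[where w = "\<lambda>w. indicator (strip M) w * \<bar>f (p * M powr (p - 1))\<bar>"])
  have [measurable]: "f \<in> borel_measurable borel" using f by (intro borel_measurable_continuous_onI)
  have [measurable]: "Measurable.pred \<Lambda> (visible \<zeta>)"
    unfolding visible_def
    by (intro pred_intros_countable pred_intros_logic measurable_below measurable_const measurable_ident_intensity)
       (simp add: space_pair_measure)
  show "(\<lambda>w. indicator (strip M) w * (f (score p (snd w)) * of_bool (visible \<zeta> w))) \<in> borel_measurable \<Lambda>"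
    by measurable
  show "(\<lambda>w. indicator (strip M) w * (f (cell_score m (cell_of m w)) * empty_below M m \<zeta> (cell_of m w))) \<in> borel_measurable \<Lambda>" for m
    by measurable
  show "integrable \<Lambda> (\<lambda>w. indicator (strip M) w * \<bar>f (p * M powr (p - 1))\<bar>)"
    using strip_finite by (intro integrable_mult_left) auto
  show "AE w in \<Lambda>. (\<lambda>m. indicator (strip M) w * (f (cell_score m (cell_of m w)) * empty_below M m \<zeta> (cell_of m w)))
      \<longlonglongrightarrow> indicator (strip M) w * (f (score p (snd w)) * of_bool (visible \<zeta> w))"
  proof (rule AE_I2)
    fix w
    show "(\<lambda>m. indicator (strip M) w * (f (cell_score m (cell_of m w)) * empty_below M m \<zeta> (cell_of m w)))
      \<longlonglongrightarrow> indicator (strip M) w * (f (score p (snd w)) * of_bool (visible \<zeta> w))"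
    proof (cases "w \<in> strip M")
      case True
      have "(\<lambda>m. f (cell_score m (cell_of m w))) \<longlonglongrightarrow> f (score p (snd w))"
        unfolding cell_score_cell_of
        by (rule continuous_on_tendsto_compose[OF f(1) tendsto_score_floor]) auto
      then show ?thesis by (intro tendsto_intros tendsto_empty_below \<zeta> M True)
    qed simp
  qed
  show "AE w in \<Lambda>. norm (indicator (strip M) w * (f (cell_score m (cell_of m w)) * empty_below M m \<zeta> (cell_of m w)))
      \<le> indicator (strip M) w * \<bar>f (p * M powr (p - 1))\<bar>" for m
  proof (rule AE_I2)
    fix w
    show "norm (indicator (strip M) w * (f (cell_score m (cell_of m w)) * empty_below M m \<zeta> (cell_of m w)))
      \<le> indicator (strip M) w * \<bar>f (p * M powr (p - 1))\<bar>"
    proof (cases "w \<in> strip M")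
      case True
      have "\<bar>f (cell_score m (cell_of m w))\<bar> \<le> \<bar>f (p * M powr (p - 1))\<bar>"
        using abs_cell_score_le[OF True M(2), of m] p by (intro f(2)) (auto simp: abs_mult)
      then have "\<bar>f (cell_score m (cell_of m w))\<bar> * empty_below M m \<zeta> (cell_of m w) \<le> \<bar>f (p * M powr (p - 1))\<bar> * 1"
        using empty_below_bounds by (intro mult_mono) auto
      then show ?thesis using True empty_below_bounds(1) by (simp add: abs_mult)
    qed simp
  qed
qed

lemma tendsto_grid_error:
  assumes \<zeta>: "good \<zeta>" and M: "\<And>x. \<bar>gc x\<bar> \<le> M" "0 < M"
  shows "(\<lambda>m. grid_error M m \<zeta>) \<longlonglongrightarrow> strip_error M \<zeta>"
proof -
  have fin: "finite {j. snd (\<zeta> j) < M}" using \<zeta> by (auto simp: good_def)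
  have 1: "grid_error M m \<zeta> = (\<Sum>j | snd (\<zeta> j) < M. cell_score m (cell_of m (\<zeta> j)) * empty_below M m \<zeta> (cell_of m (\<zeta> j)))
      - (\<integral>w. indicator (strip M) w * (cell_score m (cell_of m w) * empty_below M m \<zeta> (cell_of m w)) \<partial>\<Lambda>)" for m
    unfolding integral_cells[of M "\<lambda>i. cell_score m i * empty_below M m \<zeta> i"]
      sum_cells[OF \<zeta> M(1), where f = "\<lambda>i. cell_score m i * empty_below M m \<zeta> i", symmetric]
      sum_subtractf[symmetric] grid_error_def
    by (intro sum.cong) (auto simp: algebra_simps)
  have 2: "(\<Sum>j. of_bool (snd (\<zeta> j) < M) * (score p (snd (\<zeta> j)) * of_bool (visible \<zeta> (\<zeta> j))))
      = (\<Sum>j | snd (\<zeta> j) < M. score p (snd (\<zeta> j)) * of_bool (visible \<zeta> (\<zeta> j)))"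
    by (subst suminf_finite[OF fin]) auto
  have 3: "(\<lambda>m. cell_score m (cell_of m (\<zeta> j)) * empty_below M m \<zeta> (cell_of m (\<zeta> j)))
      \<longlonglongrightarrow> score p (snd (\<zeta> j)) * of_bool (visible \<zeta> (\<zeta> j))" if "snd (\<zeta> j) < M" for j
    unfolding cell_score_cell_of
    using that good_strip[OF \<zeta> M(1)] by (intro tendsto_mult tendsto_score_floor tendsto_empty_below \<zeta> M(1)) auto
  show ?thesis
    unfolding 1 strip_error_def 2
    by (intro tendsto_diff tendsto_sum 3 tendsto_cell_integral[where f = "\<lambda>x. x"] \<zeta> M) auto
qed

text \<open>On the grid the second moment is exactly the mean of a discretized
  \<open>strip_var\<close>. These variables are bounded by one constant for all meshes, so their
  means converge; only the passage for the error itself costs the equality.\<close>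

lemma strip_error_moments:
  assumes M: "\<And>x. \<bar>gc x\<bar> \<le> M" "0 < M"
  shows "integrable P (\<lambda>\<zeta>. (strip_error M \<zeta>)\<^sup>2)" "expectation (strip_error M) = 0"
    "expectation (\<lambda>\<zeta>. (strip_error M \<zeta>)\<^sup>2) \<le> expectation (strip_var M)"
proof -
  have [measurable]: "(\<lambda>\<zeta>. empty_below M m \<zeta> i) \<in> borel_measurable P" for m i
    unfolding empty_below_def by measurable
  have [measurable]: "grid_error M m \<in> borel_measurable P" for m
    unfolding grid_error_def by measurable
  let ?V = "\<lambda>m \<zeta>. \<integral>w. indicator (strip M) w * ((cell_score m (cell_of m w))\<^sup>2 * empty_below M m \<zeta> (cell_of m w)) \<partial>\<Lambda>"
  have V: "?V m \<zeta> = (\<Sum>i\<in>cells M m. (cell_score m i)\<^sup>2 * empty_below M m \<zeta> i * measure \<Lambda> (cell m i))" for m \<zeta>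
    using integral_cells[of M "\<lambda>i. (cell_score m i)\<^sup>2 * empty_below M m \<zeta> i" m] by simp
  have eb_int: "integrable P (\<lambda>\<zeta>. empty_below M m \<zeta> i)" for m i
    by (rule integrable_const_bound[where B = 1]) (use empty_below_bounds in auto)
  have EV: "expectation (\<lambda>\<zeta>. (grid_error M m \<zeta>)\<^sup>2) = expectation (?V m)" for m
    unfolding grid_error_moments V using eb_int
    by (subst Bochner_Integration.integral_sum) (auto intro!: sum.cong)
  have Vm [measurable]: "?V m \<in> borel_measurable P" for m
    unfolding V by measurable
  have "(\<lambda>m. expectation (?V m)) \<longlonglongrightarrow> expectation (strip_var M)"
  proof (rule integral_dominated_convergence[where w = "\<lambda>_. (p * M powr (p - 1))\<^sup>2 * measure \<Lambda> (strip M)"])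
    show "AE \<zeta> in P. (\<lambda>m. ?V m \<zeta>) \<longlonglongrightarrow> strip_var M \<zeta>"
      using AE_good
    proof eventually_elim
      case (elim \<zeta>)
      show ?case unfolding strip_var_def
        by (intro tendsto_cell_integral[where f = "\<lambda>x. x\<^sup>2"] elim M continuous_intros) (auto simp: abs_le_square_iff)
    qed
    show "AE \<zeta> in P. norm (?V m \<zeta>) \<le> (p * M powr (p - 1))\<^sup>2 * measure \<Lambda> (strip M)" for m
    proof (rule AE_I2)
      fix \<zeta>
      have "norm (?V m \<zeta>) = ?V m \<zeta>" using empty_below_bounds(1) by (simp add: abs_of_nonneg integral_nonneg_AE)
      also have "\<dots> \<le> (\<integral>w. indicator (strip M) w * (p * M powr (p - 1))\<^sup>2 \<partial>\<Lambda>)"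
      proof (rule integral_mono')
        show "integrable \<Lambda> (\<lambda>w. indicator (strip M) w * (p * M powr (p - 1))\<^sup>2)"
          using strip_finite by (intro integrable_mult_left) auto
        fix w
        show "indicator (strip M) w * ((cell_score m (cell_of m w))\<^sup>2 * empty_below M m \<zeta> (cell_of m w))
            \<le> indicator (strip M) w * (p * M powr (p - 1))\<^sup>2"
        proof (cases "w \<in> strip M")
          case True
          have "(cell_score m (cell_of m w))\<^sup>2 \<le> (p * M powr (p - 1))\<^sup>2"
            using power_mono[OF abs_cell_score_le[OF True M(2), of m], of 2] by simp
          then have "(cell_score m (cell_of m w))\<^sup>2 * empty_below M m \<zeta> (cell_of m w) \<le> (p * M powr (p - 1))\<^sup>2 * 1"
            using empty_below_bounds by (intro mult_mono) auto
          then show ?thesis using True by simp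
        qed simp
      qed auto
      also have "\<dots> = (p * M powr (p - 1))\<^sup>2 * measure \<Lambda> (strip M)"
        using sets.sets_into_space[OF strip_sets, of M] by (simp add: Int_absorb2 del: space_intensity)
      finally show "norm (?V m \<zeta>) \<le> (p * M powr (p - 1))\<^sup>2 * measure \<Lambda> (strip M)" .
    qed
  qed auto
  note lim = L2_bounded_limit[where X = "grid_error M" and Y = "strip_error M" and K = "\<lambda>m. expectation (?V m)", OF _ _ _ _ _ _ this]
  have AE: "AE \<zeta> in P. (\<lambda>m. grid_error M m \<zeta>) \<longlonglongrightarrow> strip_error M \<zeta>"
    using AE_good by eventually_elim (intro tendsto_grid_error M)
  show "integrable P (\<lambda>\<zeta>. (strip_error M \<zeta>)\<^sup>2)" "expectation (strip_error M) = 0"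
    "expectation (\<lambda>\<zeta>. (strip_error M \<zeta>)\<^sup>2) \<le> expectation (strip_var M)"
    using lim[OF _ _ AE grid_error_moments(1,2)] EV by auto
qed

subsection \<open>The error of the estimator\<close>

lemma bdd_below_mle: "good \<zeta> \<Longrightarrow> bdd_below (range (\<lambda>k. snd (\<zeta> k) + R * \<bar>x - fst (\<zeta> k)\<bar> powr \<beta>))"
proof (rule bdd_belowI2)
  fix k assume "good \<zeta>"
  then have "gc (fst (\<zeta> k)) \<le> snd (\<zeta> k)" by (auto simp: good_def)
  then show "gc x \<le> snd (\<zeta> k) + R * \<bar>x - fst (\<zeta> k)\<bar> powr \<beta>"
    using gc_holder[of x "fst (\<zeta> k)"] by linarith
qed

text \<open>A number is at most an infimum iff it is at most every term; strictness in
  \<open>below\<close> makes points on the graph of \<open>mle\<close> visible.\<close>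

lemma visible_iff_le_mle: "good \<zeta> \<Longrightarrow> visible \<zeta> w \<longleftrightarrow> snd w \<le> mle \<beta> R \<zeta> (fst w)"
  unfolding mle_def by (subst le_cINF_iff) (auto simp: bdd_below_mle visible_def below_def not_less)

lemma gc_le_mle:
  assumes "good \<zeta>"
  shows "gc x \<le> mle \<beta> R \<zeta> x"
  unfolding mle_def
proof (rule cINF_greatest)
  fix k
  have "gc (fst (\<zeta> k)) \<le> snd (\<zeta> k)" using assms by (auto simp: good_def)
  then show "gc x \<le> snd (\<zeta> k) + R * \<bar>x - fst (\<zeta> k)\<bar> powr \<beta>"
    using gc_holder[of x "fst (\<zeta> k)"] by linarith
qed simp

text \<open>A single cone has oscillation at most \<open>R\<close> over [0,1]. This yields the
  random height beyond which the cut of the strip has no effect.\<close>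

lemma mle_le:
  assumes "good \<zeta>" "x \<in> {0..1}"
  shows "mle \<beta> R \<zeta> x \<le> snd (\<zeta> 0) + R"
proof -
  have "\<zeta> 0 \<in> space \<Lambda>" using assms(1) unfolding good_def by blast
  then have "\<bar>x - fst (\<zeta> 0)\<bar> \<le> 1" using assms(2) by (auto simp: mem_Times_iff)
  then have "R * \<bar>x - fst (\<zeta> 0)\<bar> powr \<beta> \<le> R * 1"
    using R beta by (intro mult_left_mono powr_le1) auto
  moreover have "mle \<beta> R \<zeta> x \<le> snd (\<zeta> 0) + R * \<bar>x - fst (\<zeta> 0)\<bar> powr \<beta>"
    unfolding mle_def by (rule cINF_lower[OF bdd_below_mle[OF assms(1)]]) simp
  ultimately show ?thesis by simp
qed

lemma measurable_mle: "(\<lambda>(\<zeta>, x). mle \<beta> R \<zeta> x) \<in> borel_measurable (P \<Otimes>\<^sub>M lborel)"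
  unfolding mle_def split_beta' by measurable

lemma measurable_mle_borel: "mle \<beta> R \<zeta> \<in> borel_measurable borel"
  unfolding mle_def by measurable

lemma measurable_F_hat [measurable]: "F_hat \<beta> R p n \<in> borel_measurable P"
proof -
  have [measurable]: "(\<lambda>x. mle \<beta> R (fst x) (snd x)) \<in> borel_measurable (P \<Otimes>\<^sub>M lborel)"
    using measurable_mle by (simp add: split_beta')
  have [measurable]: "(\<lambda>\<zeta>. LINT x:{0..1}|lborel. \<bar>mle \<beta> R \<zeta> x\<bar> powr p) \<in> borel_measurable P"
    unfolding set_lebesgue_integral_def
    by (rule lborel.borel_measurable_lebesgue_integral) (simp add: split_beta', measurable)
  have "(\<lambda>\<zeta>. mle \<beta> R \<zeta> (fst (\<zeta> j))) \<in> borel_measurable P" for j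
    unfolding mle_def by measurable
  then have [measurable]: "Measurable.pred P (\<lambda>\<zeta>. snd (\<zeta> j) \<le> mle \<beta> R \<zeta> (fst (\<zeta> j)))" for j
    unfolding pred_def by (intro borel_measurable_le) measurable
  show ?thesis
    unfolding F_hat_def by measurable
qed

lemma integral_intensity:
  fixes f :: "real \<times> real \<Rightarrow> real"
  assumes f [measurable]: "f \<in> borel_measurable (borel \<Otimes>\<^sub>M borel)" and int: "integrable \<Lambda> f"
  shows "(\<integral>w. f w \<partial>\<Lambda>) = real n * (\<integral>x. indicator {0..1} x * (LINT y:{gc x..}|lborel. f (x, y)) \<partial>lborel)"
proof -
  let ?S = "{0..1::real} \<times> (UNIV::real set)" and ?d = "\<lambda>w. real n * indicator {w. gc (fst w) \<le> snd w} w :: real"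
  have f' [measurable]: "f \<in> borel_measurable (restrict_space lborel ?S)"
    using f by (intro measurable_restrict_space1) (simp add: borel_prod)
  have d: "?d \<in> borel_measurable (borel \<Otimes>\<^sub>M borel)" by measurable
  then have d' [measurable]: "?d \<in> borel_measurable (restrict_space lborel ?S)"
    by (intro measurable_restrict_space1) (simp add: borel_prod)
  have \<Lambda>: "\<Lambda> = density (restrict_space lborel ?S) (\<lambda>w. ennreal (?d w))"
    unfolding intensity_eq by (intro arg_cong2[where f = density] refl ext) (auto simp: indicator_def ennreal_of_nat_eq_real_of_nat)
  have int1: "integrable (restrict_space lborel ?S) (\<lambda>w. ?d w *\<^sub>R f w)"
    using int unfolding \<Lambda> by (subst (asm) integrable_density) auto
  have int2: "integrable lborel (\<lambda>w. indicator ?S w *\<^sub>R (?d w *\<^sub>R f w))"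
    using int1 strip_borel[unfolded borel_prod] by (subst (asm) integrable_restrict_space) auto
  have "(\<integral>w. f w \<partial>\<Lambda>) = (\<integral>w. ?d w *\<^sub>R f w \<partial>restrict_space lborel ?S)"
    unfolding \<Lambda> by (rule integral_density) auto
  also have "\<dots> = (\<integral>w. indicator ?S w *\<^sub>R (?d w *\<^sub>R f w) \<partial>lborel)"
    using strip_borel[unfolded borel_prod] by (intro integral_restrict_space) auto
  also have "\<dots> = (\<integral>x. (\<integral>y. indicator ?S (x, y) *\<^sub>R (?d (x, y) *\<^sub>R f (x, y)) \<partial>lborel) \<partial>lborel)"
    using lborel_pair.integral_fst'[of "\<lambda>w. indicator ?S w *\<^sub>R (?d w *\<^sub>R f w)"] int2 by (simp only: lborel_prod)
  also have "\<dots> = (\<integral>x. real n * (indicator {0..1} x * (LINT y:{gc x..}|lborel. f (x, y))) \<partial>lborel)"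
  proof (rule Bochner_Integration.integral_cong[OF refl])
    fix x
    have "(\<integral>y. indicator ?S (x, y) *\<^sub>R (?d (x, y) *\<^sub>R f (x, y)) \<partial>lborel)
        = (\<integral>y. (real n * indicator {0..1} x) * (indicator {gc x..} y *\<^sub>R f (x, y)) \<partial>lborel)"
      by (intro Bochner_Integration.integral_cong) (auto simp: indicator_def)
    then show "(\<integral>y. indicator ?S (x, y) *\<^sub>R (?d (x, y) *\<^sub>R f (x, y)) \<partial>lborel)
        = real n * (indicator {0..1} x * (LINT y:{gc x..}|lborel. f (x, y)))"
      by (simp add: set_lebesgue_integral_def mult.assoc)
  qed
  finally show ?thesis by simp
qed

text \<open>Over each \<open>x\<close> the visible heights in the support form the interval from
  \<open>gc x\<close> to \<open>mle x\<close>, on which the score integrates to the difference of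
  the \<open>p\<close>-th powers. The compensator is therefore \<open>n\<close> times the error of
  the plug-in integral.\<close>

lemma integral_visible_score:
  assumes \<zeta>: "good \<zeta>" and M: "\<And>x. \<bar>gc x\<bar> \<le> real M" "snd (\<zeta> 0) + R < M"
  shows "(\<integral>w. indicator (strip M) w * (score p (snd w) * of_bool (visible \<zeta> w)) \<partial>\<Lambda>)
    = real n * ((LINT x:{0..1}|lborel. \<bar>mle \<beta> R \<zeta> x\<bar> powr p) - Lq_norm_pow p g)"
proof -
  let ?m = "mle \<beta> R \<zeta>"
  let ?f = "\<lambda>w. indicator {y. - real M \<le> y \<and> y < real M} (snd w) * (score p (snd w) * of_bool (snd w \<le> ?m (fst w))) :: real"
  have [measurable]: "?m \<in> borel_measurable borel" by (rule measurable_mle_borel)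
  have bnd: "\<bar>?m x\<bar> \<le> M" if "x \<in> {0..1}" for x
    using mle_le[OF \<zeta> that] gc_le_mle[OF \<zeta>, of x] M(1)[of x] M(2) by auto
  have M0: "real M \<ge> 0" using M(1)[of 0] by linarith
  have "(\<integral>w. indicator (strip M) w * (score p (snd w) * of_bool (visible \<zeta> w)) \<partial>\<Lambda>) = (\<integral>w. ?f w \<partial>\<Lambda>)"
    using visible_iff_le_mle[OF \<zeta>] by (intro Bochner_Integration.integral_cong) (auto simp: strip_def indicator_def)
  also have "\<dots> = real n * (\<integral>x. indicator {0..1} x * (LINT y:{gc x..}|lborel. ?f (x, y)) \<partial>lborel)"
  proof (rule integral_intensity)
    show "?f \<in> borel_measurable (borel \<Otimes>\<^sub>M borel)" by measurable
    show "integrable \<Lambda> ?f"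
    proof (rule Bochner_Integration.integrable_bound)
      show "integrable \<Lambda> (\<lambda>w. indicator (strip M) w * (p * (real M + 1) powr (p - 1)))"
        using strip_finite by (intro integrable_mult_left) auto
      show "AE w in \<Lambda>. norm (?f w) \<le> norm (indicator (strip M) w * (p * (real M + 1) powr (p - 1)))"
      proof (rule AE_I2)
        fix w assume "w \<in> space \<Lambda>"
        then show "norm (?f w) \<le> norm (indicator (strip M) w * (p * (real M + 1) powr (p - 1)))"
          using p abs_score_le[OF p, of "snd w" "real M + 1"]
          by (auto simp: strip_def indicator_def abs_mult abs_le_iff)
      qed
    qed measurable
  qed
  also have "(\<lambda>x. indicator {0..1} x * (LINT y:{gc x..}|lborel. ?f (x, y)))
      = (\<lambda>x. indicator {0..1} x * (\<bar>?m x\<bar> powr p) - indicator {0..1} x * (\<bar>gc x\<bar> powr p))"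
  proof
    fix x
    show "indicator {0..1} x * (LINT y:{gc x..}|lborel. ?f (x, y))
      = indicator {0..1} x * (\<bar>?m x\<bar> powr p) - indicator {0..1} x * (\<bar>gc x\<bar> powr p)"
    proof (cases "x \<in> {0..1}")
      case True
      have "(LINT y:{gc x..}|lborel. ?f (x, y)) = (LINT y:{gc x..?m x}|lborel. score p y)"
        unfolding set_lebesgue_integral_def
        using M(1)[of x] mle_le[OF \<zeta> True] M(2)
        by (intro Bochner_Integration.integral_cong) (auto simp: indicator_def abs_le_iff)
      then show ?thesis
        using set_integral_score[OF p gc_le_mle[OF \<zeta>, of x]] True by simp
    qed simp
  qed
  also have "(\<integral>x. indicator {0..1} x * (\<bar>?m x\<bar> powr p) - indicator {0..1} x * (\<bar>gc x\<bar> powr p) \<partial>lborel)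
      = (\<integral>x. indicator {0..1} x * (\<bar>?m x\<bar> powr p) \<partial>lborel) - (\<integral>x. indicator {0..1} x * (\<bar>gc x\<bar> powr p) \<partial>lborel)"
  proof (rule Bochner_Integration.integral_diff)
    have I: "integrable lborel (\<lambda>x. indicator {0..1::real} x * (real M powr p))"
      by (intro integrable_mult_left) simp
    show "integrable lborel (\<lambda>x. indicator {0..1} x * (\<bar>?m x\<bar> powr p))"
      by (rule Bochner_Integration.integrable_bound[OF I])
        (use p bnd in \<open>auto simp: indicator_def intro!: powr_mono2\<close>)
    show "integrable lborel (\<lambda>x. indicator {0..1} x * (\<bar>gc x\<bar> powr p))"
      by (rule Bochner_Integration.integrable_bound[OF I])
        (use p M(1) in \<open>auto simp: indicator_def intro!: powr_mono2\<close>)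
  qed
  also have "(\<integral>x. indicator {0..1} x * (\<bar>gc x\<bar> powr p) \<partial>lborel) = Lq_norm_pow p g"
    using p unfolding Lq_norm_pow_def set_lebesgue_integral_def
    by (auto intro!: Bochner_Integration.integral_cong simp: indicator_def gc_eq)
  finally show ?thesis by (simp add: set_lebesgue_integral_def)
qed

text \<open>The points counted by the estimator lie on or under the graph of \<open>mle\<close>,
  hence below \<open>M\<close>, and the cut removes none of them.\<close>

lemma strip_error_eq:
  assumes \<zeta>: "good \<zeta>" and M: "\<And>x. \<bar>gc x\<bar> \<le> real M" "snd (\<zeta> 0) + R < M"
  shows "strip_error M \<zeta> = - real n * (F_hat \<beta> R p n \<zeta> - Lq_norm_pow p g)"
proof -
  have "of_bool (snd (\<zeta> j) < M) * (score p (snd (\<zeta> j)) * of_bool (visible \<zeta> (\<zeta> j)))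
      = p * \<bar>snd (\<zeta> j)\<bar> powr (p - 1) * sgn (snd (\<zeta> j)) * of_bool (mle \<beta> R \<zeta> (fst (\<zeta> j)) \<ge> snd (\<zeta> j))" for j
  proof (cases "visible \<zeta> (\<zeta> j)")
    case True
    have "\<zeta> j \<in> space \<Lambda>" using \<zeta> unfolding good_def by blast
    then have "fst (\<zeta> j) \<in> {0..1}" by (auto simp: mem_Times_iff)
    from mle_le[OF \<zeta> this] show ?thesis
      using True M(2) visible_iff_le_mle[OF \<zeta>, of "\<zeta> j"] by (simp add: score_def)
  next
    case False
    then show ?thesis using visible_iff_le_mle[OF \<zeta>, of "\<zeta> j"] by simp
  qed
  then show ?thesis
    unfolding strip_error_def integral_visible_score[OF assms] F_hat_def
    using n by (simp add: field_simps)
qed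

subsection \<open>Tail bounds\<close>

text \<open>The inverse of the scale of the fluctuations of \<open>mle x - g x\<close>.\<close>

definition rate :: real where
  "rate = real n powr (\<beta> / (\<beta> + 1))"

lemma rate_pos: "rate > 0"
  using n by (simp add: rate_def)

lemma rate_le: "rate \<le> real n"
proof -
  have "real n powr (\<beta> / (\<beta> + 1)) \<le> real n powr 1"
    using n beta by (intro powr_mono) auto
  then show ?thesis using n by (simp add: rate_def)
qed

lemma rate_powr: "rate powr (1 + 1 / \<beta>) = real n"
proof -
  have "1 + 1 / \<beta> = (\<beta> + 1) / \<beta>" using beta by (simp add: add_divide_distrib)
  then have "\<beta> / (\<beta> + 1) * (1 + 1 / \<beta>) = 1" using beta by simp
  then show ?thesis using n by (simp only: rate_def powr_powr) simp
qed

text \<open>On an interval of length \<open>d / 2\<close> around \<open>x\<close>, where \<open>2 * R * d powr \<beta> \<le> s / 2\<close>, the region below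
  \<open>(x, g x + s)\<close> contains all points at height at most \<open>s / 2\<close> above the graph of \<open>g\<close>.\<close>

lemma intensity_below_ge:
  assumes x: "x \<in> {0..1}" and s: "s > 0" and d: "0 < d" "d \<le> 1" "R * d powr \<beta> \<le> s / 4"
  shows "real n * s * d / 4 \<le> measure \<Lambda> {v\<in>space \<Lambda>. below \<beta> R (x, gc x + s) v}"
proof -
  \<comment> \<open>One side of \<open>x\<close> always leaves room for an interval of length
    \<open>1 / 2\<close> inside [0,1], hence for \<open>d / 2\<close>.\<close>
  define I where "I = (if x \<le> 1 / 2 then {x..x + d / 2} else {x - d / 2..x})"
  have I: "I \<subseteq> {0..1}" "emeasure lborel I = ennreal (d / 2)" "I \<in> sets borel"
    and Id: "\<And>u. u \<in> I \<Longrightarrow> \<bar>x - u\<bar> \<le> d"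
    using x d by (auto simp: I_def abs_le_iff split: if_splits)
  \<comment> \<open>Two Hoelder errors of at most \<open>s / 4\<close> occur, one from the cone and
    one from the variation of \<open>gc\<close>; this leaves height \<open>s / 2\<close>.\<close>
  have near: "below \<beta> R (x, gc x + s) (u, y)" if u: "u \<in> I" and y: "y < gc u + s / 2" for u y
  proof -
    have "R * \<bar>x - u\<bar> powr \<beta> \<le> R * d powr \<beta>"
      using R beta Id[OF u] by (intro mult_left_mono powr_mono2) auto
    moreover have "gc u \<le> gc x + R * \<bar>x - u\<bar> powr \<beta>"
      using gc_holder[of x u] by linarith
    ultimately show ?thesis using y d by (simp add: below_def)
  qed
  let ?D = "{v. below \<beta> R (x, gc x + s) v}"
  have D: "?D \<in> sets (borel \<Otimes>\<^sub>M borel)"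
    by (intro sets_borel_pairI measurable_below measurable_const measurable_ident_borel_pair) (simp add: space_pair_measure)
  have "ennreal (real n * s * d / 4) = of_nat n * (ennreal (s / 2) * emeasure lborel I)"
    using s d by (simp add: I(2) ennreal_of_nat_eq_real_of_nat ennreal_mult'[symmetric])
  also have "ennreal (s / 2) * emeasure lborel I = (\<integral>\<^sup>+u. ennreal (s / 2) * indicator I u \<partial>lborel)"
    using I(3) by (simp add: nn_integral_cmult_indicator)
  also have "\<dots> \<le> (\<integral>\<^sup>+u. emeasure lborel {y. (u, y) \<in> ?D \<and> gc u \<le> y} * indicator {0..1} u \<partial>lborel)"
  proof (rule nn_integral_mono)
    fix u
    show "ennreal (s / 2) * indicator I u \<le> emeasure lborel {y. (u, y) \<in> ?D \<and> gc u \<le> y} * indicator {0..1} u"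
    proof (cases "u \<in> I")
      case True
      have "ennreal (s / 2) = emeasure lborel {gc u..<gc u + s / 2}" using s by simp
      also have "\<dots> \<le> emeasure lborel {y. (u, y) \<in> ?D \<and> gc u \<le> y}"
      proof (rule emeasure_mono)
        have "(\<lambda>y. (u, y)) \<in> borel \<rightarrow>\<^sub>M borel \<Otimes>\<^sub>M (borel :: real measure)" by measurable
        from measurable_sets[OF this D] have "{y. (u, y) \<in> ?D} \<inter> {gc u..} \<in> sets lborel" by (simp add: vimage_def)
        then show "{y. (u, y) \<in> ?D \<and> gc u \<le> y} \<in> sets lborel" by (simp add: Int_def)
      qed (use near True in auto)
      finally show ?thesis using True I(1) by (auto simp: indicator_def)
    qed simp
  qed
  also have "of_nat n * \<dots> = emeasure \<Lambda> (?D \<inter> space \<Lambda>)"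
    by (rule emeasure_intensity[OF D, symmetric])
  finally have "ennreal (real n * s * d / 4) \<le> emeasure \<Lambda> {v\<in>space \<Lambda>. below \<beta> R (x, gc x + s) v}"
    by (simp add: mult_left_mono Int_def conj_commute del: space_intensity)
  moreover have "{v\<in>space \<Lambda>. below \<beta> R (x, gc x + s) v} \<subseteq> {v. snd v < gc x + s}"
    unfolding below_def using R by (auto intro: le_less_trans[rotated])
  then have "emeasure \<Lambda> {v\<in>space \<Lambda>. below \<beta> R (x, gc x + s) v} < \<infinity>" by (rule emeasure_intensity_le)
  ultimately show ?thesis
    by (subst (asm) emeasure_eq_ennreal_measure) (auto simp del: space_intensity)
qed

text \<open>The intensity bound of order \<open>n * s * min 1 (s powr (1 / \<beta>))\<close> is
  weakened to one linear in \<open>rate * s\<close>, so that integration leads to Gamma functions.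
  Linearity fails for \<open>rate * s\<close> below 1; the prefactor
  \<open>exp (tail_const \<beta> R)\<close> pays for that range.\<close>

lemma prob_visible_le:
  assumes x: "x \<in> {0..1}" and s: "s > 0"
  shows "prob {\<zeta>\<in>space P. visible \<zeta> (x, gc x + s)} \<le> exp (tail_const \<beta> R) * exp (- (tail_const \<beta> R * rate * s))"
proof -
  \<comment> \<open>The width that solves \<open>R * e powr \<beta> = s / 4\<close>;
    \<open>d\<close> caps it at the length of [0,1].\<close>
  define e where "e = (s / (4 * R)) powr (1 / \<beta>)"
  define d where "d = min 1 e"
  have e: "e > 0" "R * e powr \<beta> = s / 4" using s R beta by (auto simp: e_def powr_powr)
  have "R * d powr \<beta> \<le> R * e powr \<beta>"
    using R beta e by (intro mult_left_mono powr_mono2) (auto simp: d_def)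
  then have "R * d powr \<beta> \<le> s / 4" by (simp only: e(2))
  moreover have "0 < d" "d \<le> 1" using e(1) by (simp_all add: d_def)
  ultimately have "real n * s * d / 4 \<le> measure \<Lambda> {v\<in>space \<Lambda>. below \<beta> R (x, gc x + s) v}"
    using intensity_below_ge[OF x s] by blast
  moreover have "tail_const \<beta> R * (rate * s - 1) \<le> real n * s * d / 4"
  proof (cases "rate * s \<le> 1")
    case True
    then have "tail_const \<beta> R * (rate * s - 1) \<le> 0"
      using tail_const_pos[OF R, of \<beta>] by (simp add: mult_nonneg_nonpos)
    also have "0 \<le> real n * s * d / 4" using s e by (simp add: d_def)
    finally show ?thesis .
  next
    case False
    let ?k = "(4 * R) powr (- (1 / \<beta>))"
    \<comment> \<open>For \<open>rate * s > 1\<close> raising the exponent to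
      \<open>1 + 1 / \<beta>\<close> only increases the value, and by the choice of
      \<open>rate\<close> it produces exactly the factor \<open>n\<close>.\<close>
    have "rate * s = (rate * s) powr 1" using False by simp
    also have "\<dots> \<le> (rate * s) powr (1 + 1 / \<beta>)" using False beta by (intro powr_mono) auto
    also have "\<dots> = real n * (s * s powr (1 / \<beta>))"
      unfolding powr_mult rate_powr using s by (simp add: powr_add)
    finally have pow: "rate * s \<le> real n * (s * s powr (1 / \<beta>))" .
    \<comment> \<open>For wide regions \<open>rate \<le> n\<close> suffices; for narrow ones the
      width \<open>e\<close> equals \<open>?k * s powr (1 / \<beta>)\<close>.\<close>
    have "min 1 ?k * (rate * s) \<le> real n * s * d"
    proof (cases "1 \<le> e")
      case True
      have "min 1 ?k * (rate * s) \<le> 1 * (real n * s)"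
        using rate_le rate_pos s by (intro mult_mono) auto
      then show ?thesis using True by (simp add: d_def)
    next
      case False
      have "min 1 ?k * (rate * s) \<le> ?k * (real n * (s * s powr (1 / \<beta>)))"
        by (rule mult_mono[OF min.cobounded2 pow powr_ge_zero]) (simp add: rate_pos less_imp_le s)
      also have "\<dots> = real n * s * (?k * s powr (1 / \<beta>))" by (simp only: mult_ac)
      also have "?k * s powr (1 / \<beta>) = e"
        unfolding e_def powr_minus_divide using R s by (subst powr_divide) auto
      finally show ?thesis using False by (simp add: d_def)
    qed
    moreover have "tail_const \<beta> R * (rate * s - 1) \<le> tail_const \<beta> R * (rate * s)"
      using tail_const_pos[OF R, of \<beta>] by (intro mult_left_mono) auto
    moreover have "tail_const \<beta> R * (rate * s) = min 1 ?k * (rate * s) / 4"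
      unfolding tail_const_def by (simp only: times_divide_eq_left)
    ultimately show ?thesis by linarith
  qed
  ultimately have "- measure \<Lambda> {v\<in>space \<Lambda>. below \<beta> R (x, gc x + s) v} \<le> tail_const \<beta> R + - (tail_const \<beta> R * rate * s)"
    by (simp add: algebra_simps)
  then have "exp (- measure \<Lambda> {v\<in>space \<Lambda>. below \<beta> R (x, gc x + s) v}) \<le> exp (tail_const \<beta> R + - (tail_const \<beta> R * rate * s))"
    by (simp only: exp_le_cancel_iff)
  then show ?thesis by (simp only: prob_visible exp_add)
qed

section \<open>The integrated variance\<close>

definition var_const :: real where
  "var_const = p\<^sup>2 * 2 powr (2 * p - 2) * exp (tail_const \<beta> R)"

lemma sets_visible: "{\<zeta>\<in>space P. visible \<zeta> w} \<in> sets P"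
  unfolding visible_def
  by (intro predE pred_intros_countable pred_intros_logic measurable_below measurable_const measurable_point)
     (simp add: space_pair_measure)

lemma measurable_prob_visible [measurable]:
  "(\<lambda>w. prob {\<zeta>\<in>space P. visible \<zeta> w}) \<in> borel_measurable (borel \<Otimes>\<^sub>M borel)"
proof -
  have [measurable]: "Measurable.pred ((borel \<Otimes>\<^sub>M borel) \<Otimes>\<^sub>M P) (\<lambda>z. visible (snd z) (fst z))"
    using measurable_compose[OF measurable_pair_swap' measurable_visible_borel] by (simp add: split_beta')
  have "(\<lambda>w. \<integral>\<zeta>. (of_bool (visible \<zeta> w) :: real) \<partial>P) \<in> borel_measurable (borel \<Otimes>\<^sub>M (borel :: real measure))"
    by (rule borel_measurable_lebesgue_integral) (simp add: split_beta', measurable)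
  moreover have "(\<integral>\<zeta>. of_bool (visible \<zeta> w) \<partial>P) = prob {\<zeta>\<in>space P. visible \<zeta> w}" for w
  proof -
    have "(\<integral>\<zeta>. (of_bool (visible \<zeta> w) :: real) \<partial>P) = (\<integral>\<zeta>. indicator {\<zeta>\<in>space P. visible \<zeta> w} \<zeta> \<partial>P)"
      by (intro Bochner_Integration.integral_cong) (auto simp: indicator_def)
    moreover have "{\<zeta>\<in>space P. visible \<zeta> w} \<inter> space P = {\<zeta>\<in>space P. visible \<zeta> w}" by auto
    ultimately show ?thesis by simp
  qed
  ultimately show ?thesis by simp
qed

lemma nn_integral_score_visible_le:
  assumes x: "x \<in> {0..1}"
  shows "(\<integral>\<^sup>+y. ennreal ((score p y)\<^sup>2 * prob {\<zeta>\<in>space P. visible \<zeta> (x, y)}) * indicator {gc x..} y \<partial>lborel)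
    \<le> ennreal (var_const * ((if 2 * p - 2 = 0 then 1 else \<bar>gc x\<bar> powr (2 * p - 2)) / (tail_const \<beta> R * rate)
        + Gamma (2 * p - 1) / (tail_const \<beta> R * rate) powr (2 * p - 1)))"
proof -
  let ?q = "2 * p - 2" and ?c = "tail_const \<beta> R * rate"
  define G where "G = (if ?q = 0 then 1 else \<bar>gc x\<bar> powr ?q)"
  have G: "G \<ge> 0" by (simp add: G_def)
  have c: "?c > 0" using tail_const_pos[OF R] rate_pos by simp
  have vc: "var_const \<ge> 0" by (simp add: var_const_def)
  have [measurable]: "(\<lambda>y. prob {\<zeta>\<in>space P. visible \<zeta> (x, y)}) \<in> borel_measurable borel"
    by (rule measurable_compose[OF _ measurable_prob_visible]) measurable
  have "(\<integral>\<^sup>+y. ennreal ((score p y)\<^sup>2 * prob {\<zeta>\<in>space P. visible \<zeta> (x, y)}) * indicator {gc x..} y \<partial>lborel)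
      = (\<integral>\<^sup>+s. ennreal ((score p (gc x + s))\<^sup>2 * prob {\<zeta>\<in>space P. visible \<zeta> (x, gc x + s)}) * indicator {gc x..} (gc x + s) \<partial>lborel)"
    by (subst nn_integral_real_affine[where c = 1 and t = "gc x"]) auto
  also have "\<dots> \<le> (\<integral>\<^sup>+s. ennreal (var_const * G) * ennreal (indicator {0..} s * (s powr 0 * exp (- (?c * s))))
      + ennreal var_const * ennreal (indicator {0..} s * (s powr ?q * exp (- (?c * s)))) \<partial>lborel)"
  proof (rule nn_integral_mono_AE)
    \<comment> \<open>The height \<open>s = 0\<close> is excluded because the tail bound needs
      \<open>s > 0\<close> and because \<open>s powr 0\<close>, which stands for 1 here, vanishes at
      0.\<close>
    have "AE s in lborel. s \<noteq> (0::real)" by (rule AE_lborel_singleton)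
    then show "AE s in lborel. ennreal ((score p (gc x + s))\<^sup>2 * prob {\<zeta>\<in>space P. visible \<zeta> (x, gc x + s)}) * indicator {gc x..} (gc x + s)
      \<le> ennreal (var_const * G) * ennreal (indicator {0..} s * (s powr 0 * exp (- (?c * s))))
      + ennreal var_const * ennreal (indicator {0..} s * (s powr ?q * exp (- (?c * s))))"
    proof eventually_elim
      case (elim s)
      show ?case
      proof (cases "s > 0")
        case True
        have "(score p (gc x + s))\<^sup>2 * prob {\<zeta>\<in>space P. visible \<zeta> (x, gc x + s)}
            \<le> (p\<^sup>2 * 2 powr ?q * (G + s powr ?q)) * (exp (tail_const \<beta> R) * exp (- (?c * s)))"
          using score_add_square_le[OF p True, of "gc x"] prob_visible_le[OF x True] G
          by (intro mult_mono) (auto simp: G_def)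
        also have "\<dots> = var_const * G * exp (- (?c * s)) + var_const * (s powr ?q * exp (- (?c * s)))"
          by (simp add: var_const_def algebra_simps)
        finally show ?thesis
          using True G vc by (simp add: ennreal_mult'[symmetric] ennreal_plus[symmetric] ennreal_leI del: ennreal_plus)
      qed (use elim in auto)
    qed
  qed
  also have "\<dots> = ennreal (var_const * G) * ennreal (Gamma (0 + 1) / ?c powr (0 + 1))
      + ennreal var_const * ennreal (Gamma (?q + 1) / ?c powr (?q + 1))"
    using p by (simp only: nn_integral_powr_exp[OF c, symmetric]) (subst nn_integral_add, (measurable)[2], simp add: nn_integral_cmult)
  also have "\<dots> = ennreal (var_const * (G / ?c + Gamma (2 * p - 1) / ?c powr (2 * p - 1)))"
    using c G vc p by (simp add: ennreal_mult'[symmetric] ennreal_plus[symmetric] algebra_simps del: ennreal_plus)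
  finally show ?thesis by (simp add: G_def)
qed

lemma Lq_norm_pow_nn_integral:
  assumes q: "q \<ge> 0"
  shows "(\<integral>\<^sup>+x. ennreal (if q = 0 then 1 else \<bar>gc x\<bar> powr q) * indicator {0..1} x \<partial>lborel) = ennreal (Lq_norm_pow q g)"
    "Lq_norm_pow q g \<ge> 0"
proof -
  obtain B :: nat where B: "\<And>x. \<bar>gc x\<bar> \<le> B" by (rule gc_bounded) blast
  have eq: "Lq_norm_pow q g = (\<integral>x. (if q = 0 then 1 else \<bar>gc x\<bar> powr q) * indicator {0..1} x \<partial>lborel)"
    unfolding Lq_norm_pow_def set_lebesgue_integral_def
    by (cases "q = 0", simp) (auto simp: gc_eq indicator_def intro!: Bochner_Integration.integral_cong)
  show "Lq_norm_pow q g \<ge> 0"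
    unfolding eq by (intro Bochner_Integration.integral_nonneg) auto
  have "integrable lborel (\<lambda>x. (if q = 0 then 1 else \<bar>gc x\<bar> powr q) * indicator {0..1} x)"
  proof (rule Bochner_Integration.integrable_bound)
    show "integrable lborel (\<lambda>x. indicator {0..1::real} x * (1 + real B powr q))"
      by (intro integrable_mult_left integrable_real_indicator) auto
    show "AE x in lborel. norm ((if q = 0 then 1 else \<bar>gc x\<bar> powr q) * indicator {0..1} x) \<le> norm (indicator {0..1::real} x * (1 + real B powr q))"
    proof (rule AE_I2)
      fix x
      have "\<bar>gc x\<bar> powr q \<le> real B powr q" using B[of x] q by (intro powr_mono2) auto
      then show "norm ((if q = 0 then 1 else \<bar>gc x\<bar> powr q) * indicator {0..1} x) \<le> norm (indicator {0..1::real} x * (1 + real B powr q))"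
        by (auto simp: indicator_def)
    qed
  qed measurable
  then show "(\<integral>\<^sup>+x. ennreal (if q = 0 then 1 else \<bar>gc x\<bar> powr q) * indicator {0..1} x \<partial>lborel) = ennreal (Lq_norm_pow q g)"
    unfolding eq by (subst nn_integral_eq_integral[symmetric]) (auto simp: ennreal_mult' ennreal_indicator intro!: nn_integral_cong)
qed

definition var_bound :: real where
  "var_bound = real n * (var_const * (Lq_norm_pow (2 * p - 2) g / (tail_const \<beta> R * rate)
        + Gamma (2 * p - 1) / (tail_const \<beta> R * rate) powr (2 * p - 1)))"

text \<open>Tonelli turns the indicator of \<open>visible\<close> into a void probability. The strip
  is dropped at the start, which makes the bound uniform in \<open>M\<close>, as the removal of the
  cut demands.\<close>

lemma expectation_strip_var_le: "expectation (strip_var M) \<le> var_bound"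
proof -
  let ?q = "2 * p - 2" and ?c = "tail_const \<beta> R * rate"
  let ?G = "\<lambda>x. if ?q = 0 then 1 else \<bar>gc x\<bar> powr ?q"
  let ?K = "Gamma (2 * p - 1) / ?c powr (2 * p - 1)"
  have c: "?c > 0" using tail_const_pos[OF R] rate_pos by simp
  have vc: "var_const \<ge> 0" by (simp add: var_const_def)
  have q: "?q \<ge> 0" using p by simp
  have K: "?K \<ge> 0" using p by (intro divide_nonneg_nonneg Gamma_real_nonneg) auto
  have vb: "var_bound \<ge> 0"
    unfolding var_bound_def
    by (intro mult_nonneg_nonneg add_nonneg_nonneg divide_nonneg_nonneg[OF Lq_norm_pow_nn_integral(2)[OF q]] K vc of_nat_0_le_iff less_imp_le[OF c])
  have split: "ennreal (var_const * (G / ?c + K)) = ennreal (var_const / ?c) * ennreal G + ennreal (var_const * K)"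
    if "0 \<le> G" "0 \<le> K" for G K
  proof -
    have "var_const * (G / ?c + K) = var_const / ?c * G + var_const * K" by (simp add: distrib_left)
    moreover have "0 \<le> var_const / ?c" using c vc by simp
    ultimately show ?thesis using that vc by (simp only: ennreal_plus mult_nonneg_nonneg ennreal_mult')
  qed
  have Gm: "(\<lambda>x. ennreal (?G x) * indicator {0..1::real} x) \<in> borel_measurable lborel"
    by (cases "?q = 0"; simp)
  interpret PL: pair_sigma_finite P \<Lambda> ..
  have le: "ennreal (strip_var M \<zeta>) \<le> (\<integral>\<^sup>+w. ennreal ((score p (snd w))\<^sup>2 * of_bool (visible \<zeta> w)) \<partial>\<Lambda>)" for \<zeta>
  proof (cases "integrable \<Lambda> (\<lambda>w. indicator (strip M) w * ((score p (snd w))\<^sup>2 * of_bool (visible \<zeta> w)))")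
    case True
    then have "ennreal (strip_var M \<zeta>) = (\<integral>\<^sup>+w. ennreal (indicator (strip M) w * ((score p (snd w))\<^sup>2 * of_bool (visible \<zeta> w))) \<partial>\<Lambda>)"
      unfolding strip_var_def by (intro nn_integral_eq_integral[symmetric]) auto
    also have "\<dots> \<le> (\<integral>\<^sup>+w. ennreal ((score p (snd w))\<^sup>2 * of_bool (visible \<zeta> w)) \<partial>\<Lambda>)"
      by (intro nn_integral_mono) (auto simp: indicator_def)
    finally show ?thesis .
  qed (simp add: strip_var_def not_integrable_integral_eq)
  have sv0: "strip_var M \<zeta> \<ge> 0" for \<zeta>
    unfolding strip_var_def by (intro Bochner_Integration.integral_nonneg) auto
  have "(\<integral>\<^sup>+\<zeta>. ennreal (strip_var M \<zeta>) \<partial>P) \<le> (\<integral>\<^sup>+\<zeta>. (\<integral>\<^sup>+w. ennreal ((score p (snd w))\<^sup>2 * of_bool (visible \<zeta> w)) \<partial>\<Lambda>) \<partial>P)"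
    by (intro nn_integral_mono le)
  also have "\<dots> = (\<integral>\<^sup>+w. (\<integral>\<^sup>+\<zeta>. ennreal ((score p (snd w))\<^sup>2 * of_bool (visible \<zeta> w)) \<partial>P) \<partial>\<Lambda>)"
    by (intro PL.Fubini'[symmetric]) (simp add: split_beta', measurable)
  also have "\<dots> = (\<integral>\<^sup>+w. ennreal ((score p (snd w))\<^sup>2 * prob {\<zeta>\<in>space P. visible \<zeta> w}) \<partial>\<Lambda>)"
  proof (rule nn_integral_cong)
    fix w
    have [measurable]: "{\<zeta>\<in>space P. visible \<zeta> w} \<in> sets P"
      by (rule sets_visible)
    have "(\<integral>\<^sup>+\<zeta>. ennreal ((score p (snd w))\<^sup>2 * of_bool (visible \<zeta> w)) \<partial>P)
        = (\<integral>\<^sup>+\<zeta>. ennreal ((score p (snd w))\<^sup>2) * indicator {\<zeta>\<in>space P. visible \<zeta> w} \<zeta> \<partial>P)"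
      by (intro nn_integral_cong) (auto simp: indicator_def)
    also have "\<dots> = ennreal ((score p (snd w))\<^sup>2 * prob {\<zeta>\<in>space P. visible \<zeta> w})"
      by (simp add: nn_integral_cmult_indicator emeasure_eq_measure ennreal_mult')
    finally show "(\<integral>\<^sup>+\<zeta>. ennreal ((score p (snd w))\<^sup>2 * of_bool (visible \<zeta> w)) \<partial>P)
        = ennreal ((score p (snd w))\<^sup>2 * prob {\<zeta>\<in>space P. visible \<zeta> w})" .
  qed
  also have "\<dots> = of_nat n * (\<integral>\<^sup>+x. (\<integral>\<^sup>+y. ennreal ((score p (snd (x, y)))\<^sup>2 * prob {\<zeta>\<in>space P. visible \<zeta> (x, y)}) * indicator {gc x..} y \<partial>lborel) * indicator {0..1} x \<partial>lborel)"
    by (intro nn_integral_intensity) measurable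
  also have "\<dots> \<le> of_nat n * (\<integral>\<^sup>+x. ennreal (var_const / ?c) * (ennreal (?G x) * indicator {0..1} x) + ennreal (var_const * ?K) * indicator {0..1} x \<partial>lborel)"
  proof (intro mult_left_mono nn_integral_mono)
    fix x :: real
    have "ennreal (var_const * (?G x / ?c + ?K)) = ennreal (var_const / ?c) * ennreal (?G x) + ennreal (var_const * ?K)"
      by (rule split) (use K in auto)
    note eq = this
    show "(\<integral>\<^sup>+y. ennreal ((score p (snd (x, y)))\<^sup>2 * prob {\<zeta>\<in>space P. visible \<zeta> (x, y)}) * indicator {gc x..} y \<partial>lborel) * indicator {0..1} x
      \<le> ennreal (var_const / ?c) * (ennreal (?G x) * indicator {0..1} x) + ennreal (var_const * ?K) * indicator {0..1} x"
    proof (cases "x \<in> {0..1}")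
      case True
      from nn_integral_score_visible_le[OF True] show ?thesis
        unfolding eq indicator_simps(1)[OF True] mult_1_right snd_conv .
    next
      case False
      show ?thesis unfolding indicator_simps(2)[OF False] mult_zero_right add_0_left by (rule order_refl)
    qed
  qed auto
  also have "\<dots> = of_nat n * (ennreal (var_const / ?c) * ennreal (Lq_norm_pow ?q g) + ennreal (var_const * ?K))"
  proof -
    have "(\<integral>\<^sup>+x. ennreal (var_const / ?c) * (ennreal (?G x) * indicator {0..1} x) \<partial>lborel) = ennreal (var_const / ?c) * ennreal (Lq_norm_pow ?q g)"
      unfolding Lq_norm_pow_nn_integral(1)[OF q, symmetric] by (rule nn_integral_cmult[OF Gm])
    moreover have "(\<integral>\<^sup>+x. ennreal (var_const * ?K) * indicator {0..1::real} x \<partial>lborel) = ennreal (var_const * ?K)"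
      by (rule trans[OF nn_integral_cmult_indicator]) simp_all
    moreover have "(\<integral>\<^sup>+x. ennreal (var_const / ?c) * (ennreal (?G x) * indicator {0..1} x) + ennreal (var_const * ?K) * indicator {0..1} x \<partial>lborel)
       = (\<integral>\<^sup>+x. ennreal (var_const / ?c) * (ennreal (?G x) * indicator {0..1} x) \<partial>lborel) + (\<integral>\<^sup>+x. ennreal (var_const * ?K) * indicator {0..1::real} x \<partial>lborel)"
      by (rule nn_integral_add[OF borel_measurable_times_ennreal[OF borel_measurable_const Gm]]) simp
    ultimately show ?thesis by (simp only:)
  qed
  also have "\<dots> = ennreal var_bound"
    unfolding split[OF Lq_norm_pow_nn_integral(2)[OF q] K, symmetric] var_bound_def ennreal_of_nat_eq_real_of_nat
    by (rule ennreal_mult'[symmetric]) simp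
  finally have nn: "(\<integral>\<^sup>+\<zeta>. ennreal (strip_var M \<zeta>) \<partial>P) \<le> ennreal var_bound" .
  then have "integrable P (strip_var M)"
    using sv0 by (intro integrableI_nonneg) (auto intro: le_less_trans[OF _ ennreal_less_top])
  then show ?thesis
    using nn sv0 vb by (simp add: nn_integral_eq_integral)
qed

section \<open>Removal of the cut and rates\<close>

lemma F_hat_moments:
  "integrable P (F_hat \<beta> R p n)" "expectation (F_hat \<beta> R p n) = Lq_norm_pow p g"
  "integrable P (\<lambda>\<zeta>. (F_hat \<beta> R p n \<zeta> - Lq_norm_pow p g)\<^sup>2)"
  "expectation (\<lambda>\<zeta>. (F_hat \<beta> R p n \<zeta> - Lq_norm_pow p g)\<^sup>2) \<le> var_bound / (real n)\<^sup>2"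
proof -
  obtain B :: nat where B: "\<And>x. \<bar>gc x\<bar> \<le> B" by (rule gc_bounded) blast
  let ?L = "Lq_norm_pow p g"
  define Y where "Y = (\<lambda>\<zeta>. - real n * (F_hat \<beta> R p n \<zeta> - ?L))"
  \<comment> \<open>\<open>B\<close> makes the level a bound for \<open>\<bar>gc x\<bar>\<close>,
    and \<open>+ 1\<close> makes it positive.\<close>
  define X where "X = (\<lambda>k. strip_error (B + 1 + k))"
  have BM: "\<bar>gc x\<bar> \<le> real (B + 1 + k)" for x k using B[of x] by linarith
  have [measurable]: "Y \<in> borel_measurable P" unfolding Y_def by measurable
  have [measurable]: "X k \<in> borel_measurable P" for k unfolding X_def by measurable
  have lim: "AE \<zeta> in P. (\<lambda>k. X k \<zeta>) \<longlonglongrightarrow> Y \<zeta>"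
    using AE_good
  proof eventually_elim
    case (elim \<zeta>)
    have "\<forall>\<^sub>F k in sequentially. snd (\<zeta> 0) + R < real k"
      using filterlim_real_sequentially by (auto simp: filterlim_at_top_dense)
    then have "\<forall>\<^sub>F k in sequentially. X k \<zeta> = Y \<zeta>"
    proof eventually_elim
      case (elim k)
      then show ?case unfolding X_def Y_def using BM
        by (intro strip_error_eq \<open>good \<zeta>\<close>) auto
    qed
    then show ?case by (rule tendsto_eventually)
  qed
  have sq: "integrable P (\<lambda>\<zeta>. (X k \<zeta>)\<^sup>2)" and mean: "expectation (X k) = 0"
    and le: "expectation (\<lambda>\<zeta>. (X k \<zeta>)\<^sup>2) \<le> var_bound" for k
    using strip_error_moments[OF BM, of k] expectation_strip_var_le[of "B + 1 + k"] unfolding X_def by auto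
  \<comment> \<open>Second passage to the limit, now in the height: for almost every outcome the cut
    errors are eventually equal to \<open>Y\<close>, but from a random index on, so that the means
    still need the uniform bound on second moments.\<close>
  note L = L2_bounded_limit[OF _ _ lim sq mean le tendsto_const]
  have n0: "real n \<noteq> 0" using n by simp
  have Yi: "integrable P Y" by (rule square_integrable_imp_integrable) (use L in auto)
  have F: "F_hat \<beta> R p n = (\<lambda>\<zeta>. ?L - Y \<zeta> / real n)"
    using n0 by (auto simp: Y_def)
  show "integrable P (F_hat \<beta> R p n)" unfolding F using Yi by simp
  show "expectation (F_hat \<beta> R p n) = ?L" unfolding F using Yi L by (simp add: prob_space)
  have sqF: "(F_hat \<beta> R p n \<zeta> - ?L)\<^sup>2 = (Y \<zeta>)\<^sup>2 / (real n)\<^sup>2" for \<zeta>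
    using n0 by (simp add: Y_def power_mult_distrib)
  show "integrable P (\<lambda>\<zeta>. (F_hat \<beta> R p n \<zeta> - ?L)\<^sup>2)" unfolding sqF using L by simp
  show "expectation (\<lambda>\<zeta>. (F_hat \<beta> R p n \<zeta> - ?L)\<^sup>2) \<le> var_bound / (real n)\<^sup>2"
    unfolding sqF using L by (simp add: divide_right_mono)
qed

text \<open>After division by \<open>n\<close> squared the two terms carry
  \<open>1 / (n * rate)\<close> and \<open>1 / (n * rate powr (2 * p - 1))\<close>, which are the
  two rates of the theorem.\<close>

lemma var_bound_eq:
  "var_bound / (real n)\<^sup>2 = var_const * (1 / tail_const \<beta> R * (Lq_norm_pow (2 * p - 2) g * real n powr (- ((2 * \<beta> + 1) / (\<beta> + 1))))
     + Gamma (2 * p - 1) / tail_const \<beta> R powr (2 * p - 1) * real n powr (- ((2 * \<beta> * p + 1) / (\<beta> + 1))))"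
proof -
  have n0: "real n > 0" using n by simp
  have c: "tail_const \<beta> R > 0" by (rule tail_const_pos[OF R])
  have 1: "real n powr (- ((2 * \<beta> + 1) / (\<beta> + 1))) = 1 / (real n * rate)"
  proof -
    have "(2 * \<beta> + 1) / (\<beta> + 1) = 1 + \<beta> / (\<beta> + 1)" using beta by (simp add: field_simps)
    then have "real n powr ((2 * \<beta> + 1) / (\<beta> + 1)) = real n * rate" using n0 by (simp add: rate_def powr_add)
    then show ?thesis by (simp add: powr_minus divide_inverse)
  qed
  have 2: "real n powr (- ((2 * \<beta> * p + 1) / (\<beta> + 1))) = 1 / (real n * rate powr (2 * p - 1))"
  proof -
    have "(2 * \<beta> * p + 1) / (\<beta> + 1) = 1 + \<beta> / (\<beta> + 1) * (2 * p - 1)" using beta by (simp add: field_simps)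
    then have "real n powr ((2 * \<beta> * p + 1) / (\<beta> + 1)) = real n * rate powr (2 * p - 1)"
      using n0 by (simp add: rate_def powr_add powr_powr)
    then show ?thesis by (simp add: powr_minus divide_inverse)
  qed
  have "(tail_const \<beta> R * rate) powr (2 * p - 1) = tail_const \<beta> R powr (2 * p - 1) * rate powr (2 * p - 1)"
    using c rate_pos by (simp add: powr_mult)
  then show ?thesis
    unfolding var_bound_def 1 2 using n0 by (simp add: power2_eq_square field_simps)
qed

end

theorem corollary2p6:
  fixes \<beta> R p :: real
  assumes "0 < \<beta>" "\<beta> \<le> 1" "R > 0" "p \<ge> 1"
  shows "\<exists>C :: real. \<forall>n \<ge> 1. \<forall>g \<in> holder_ball \<beta> R. \<forall>P.
           poisson_point_process (ppp_intensity n g) P \<longrightarrow>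
             integrable P (F_hat \<beta> R p n) \<and>
             (\<integral>z. F_hat \<beta> R p n z \<partial>P) = Lq_norm_pow p g \<and>
             integrable P (\<lambda>z. (F_hat \<beta> R p n z - Lq_norm_pow p g)\<^sup>2) \<and>
             (\<integral>z. (F_hat \<beta> R p n z - Lq_norm_pow p g)\<^sup>2 \<partial>P)
               \<le> C * max (Lq_norm_pow (2 * p - 2) g * real n powr (- ((2 * \<beta> + 1) / (\<beta> + 1))))
                         (real n powr (- ((2 * \<beta> * p + 1) / (\<beta> + 1))))"
proof (intro exI allI ballI impI)
  fix n :: nat and g :: "real \<Rightarrow> real" and P :: "(nat \<Rightarrow> real \<times> real) measure"
  assume "n \<ge> 1" "g \<in> holder_ball \<beta> R" "poisson_point_process (ppp_intensity n g) P"
  then interpret boundary_model \<beta> R p n g P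
    using assms by unfold_locales
  \<comment> \<open>\<open>var_const\<close> is written out because the witness for \<open>C\<close>
    precedes \<open>n\<close>, \<open>g\<close> and \<open>P\<close>. The factors before
    \<open>exp\<close> come from splitting the score, the exponential from the tail bound.\<close>
  let ?v = "p\<^sup>2 * 2 powr (2 * p - 2) * exp (tail_const \<beta> R)" and ?c = "tail_const \<beta> R"
  let ?g = "Gamma (2 * p - 1) / ?c powr (2 * p - 1)"
  let ?A = "Lq_norm_pow (2 * p - 2) g * real n powr (- ((2 * \<beta> + 1) / (\<beta> + 1)))"
    and ?B = "real n powr (- ((2 * \<beta> * p + 1) / (\<beta> + 1)))"
  have c: "?c > 0" and g: "?g \<ge> 0"
    using assms by (auto intro!: tail_const_pos divide_nonneg_nonneg Gamma_real_nonneg)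
  have "?v * (1 / ?c * ?A + ?g * ?B) \<le> ?v * (1 / ?c * max ?A ?B + ?g * max ?A ?B)"
    using c g by (intro mult_left_mono add_mono) auto
  also have "\<dots> = (?v * (1 / ?c + ?g)) * max ?A ?B"
    by (simp only: distrib_right mult.assoc)
  finally have "var_bound / (real n)\<^sup>2 \<le> (?v * (1 / ?c + ?g)) * max ?A ?B"
    unfolding var_bound_eq var_const_def .
  then show "integrable P (F_hat \<beta> R p n) \<and> (\<integral>z. F_hat \<beta> R p n z \<partial>P) = Lq_norm_pow p g \<and>
      integrable P (\<lambda>z. (F_hat \<beta> R p n z - Lq_norm_pow p g)\<^sup>2) \<and>
      (\<integral>z. (F_hat \<beta> R p n z - Lq_norm_pow p g)\<^sup>2 \<partial>P) \<le> (?v * (1 / ?c + ?g)) * max ?A ?B"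
    using F_hat_moments by (blast intro: order_trans)
qed

end
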